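(* Let $(M,g)$ be any Riemannian manifold. Then the Kobayashi metric $K_M$ is well defined, namely $0\le K_M(p,X)<\infty$ for all $p\in M$ and all $X\in T_pM$.
   Context: For $R>0$ let $D_R$ be the disk of radius $R$ in $\mathbb{R}^2$ centered at the origin, with coordinates $(x,y)$ and the Euclidean metric, and let $D=D_1$ be the unit disk. A map $u:D_R\to M$ is harmonic if it is a critical point of the energy functional; in local coordinates on $M$ (of dimension $m$) it satisfies $\Delta u^{a}+\sum_{b,c=1}^m\Gamma^{a}_{bc}(u)\left(\frac{\partial u^{b}}{\partial x}\frac{\partial u^{c}}{\partial x}+\frac{\partial u^{b}}{\partial y}\frac{\partial u^{c}}{\partial y}\right)=0$ for $a=1,\dots,m$, where $\Gamma^a_{bc}$ are the Christoffel symbols of $g$ and $\Delta=\partial_x^2+\partial_y^2$. A harmonic map $u: D_R\to M$ is conformal at $0$ if $g\left(\frac{\partial u}{\partial x}(0),\frac{\partial u}{\partial x}(0)\right)=g\left(\frac{\partial u}{\partial y}(0),\frac{\partial u}{\partial y}(0)\right)$ and $g\left(\frac{\partial u}{\partial x}(0),\frac{\partial u}{\partial y}(0)\right)=0$. Definition of $K_M$: for $p\in M$ and a nonzero tangent vector $X\in T_pM$, $$K_M(p,X)=\inf\left\{\alpha:\ \alpha>0,\ \exists\text{ harmonic map }u:D\to M,\ \text{conformal at }0,\ u(0)=p,\ \tfrac{\partial u}{\partial x}(0)=\tfrac{X}{\alpha}\right\}$$ $$=\inf\left\{\tfrac1R:\ \exists\text{ harmonic map }u:D_R\to M,\ \text{conformal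 at }0,\ u(0)=p,\ \tfrac{\partial u}{\partial x}(0)=X\right\},$$ and $K_M(p,0)=0$.
   Formalization: The manifold is assumed to have dimension at least 2; in dimension 1 conformality at 0 forces ∂u/∂x(0)=0, so no admissible map exists for X≠0 and K_M(p,X)=+∞, while in dimension 0 only X=0 occurs. *)

theory Defs
  imports "HOL-Analysis.Analysis"
begin

definition partial_deriv ::
  "'v::euclidean_space \<Rightarrow> ('v \<Rightarrow> 'w::real_normed_vector) \<Rightarrow> 'v \<Rightarrow> 'w"
  where "partial_deriv e f = (\<lambda>z. frechet_derivative f (at z) e)"

text \<open>The next two notions are meant for open sets \<open>S\<close> only, since derivatives are taken
  in a full neighbourhood of each point.\<close>

primrec Ck_on ::
  "nat \<Rightarrow> ('v::euclidean_space \<Rightarrow> 'w::real_normed_vector) \<Rightarrow> 'v set \<Rightarrow> bool"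
  where
    "Ck_on 0 f S \<longleftrightarrow> continuous_on S f"
  | "Ck_on (Suc k) f S \<longleftrightarrow>
       (\<forall>x\<in>S. f differentiable (at x)) \<and> (\<forall>e\<in>Basis. Ck_on k (partial_deriv e f) S)"

definition smooth_on ::
  "('v::euclidean_space \<Rightarrow> 'w::real_normed_vector) \<Rightarrow> 'v set \<Rightarrow> bool"
  where "smooth_on f S \<longleftrightarrow> (\<forall>k. Ck_on k f S)"

text \<open>A chart is a domain together with a coordinate map; the coordinate map is only relevant on
  the domain.  The dimension of the manifold is \<open>CARD('n)\<close>.\<close>

type_synonym ('a, 'n) chart = "'a set \<times> ('a \<Rightarrow> real ^ 'n)"

definition transition ::
  "('a, 'n::finite) chart \<Rightarrow> ('a, 'n) chart \<Rightarrow> real ^ 'n \<Rightarrow> real ^ 'n"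
  where "transition c d = snd d \<circ> inv_into (fst c) (snd c)"

text \<open>\<open>A\<close> is any smooth atlas; it need not be maximal, since every atlas determines the
  differentiable structure.\<close>

locale smooth_manifold =
  fixes M :: "'a topology" and A :: "('a, 'n::finite) chart set"
  assumes Hausdorff: "Hausdorff_space M"
    and second_countable: "second_countable M"
    and cover: "(\<Union>c\<in>A. fst c) = topspace M"
    and chart_domain: "c \<in> A \<Longrightarrow> openin M (fst c)"
    and chart_image: "c \<in> A \<Longrightarrow> open (snd c ` fst c)"
    and chart_homeomorphism:
      "c \<in> A \<Longrightarrow> homeomorphic_map (subtopology M (fst c)) (top_of_set (snd c ` fst c)) (snd c)"
    and compatible:
      "c \<in> A \<Longrightarrow> d \<in> A \<Longrightarrow> smooth_on (transition c d) (snd c ` (fst c \<inter> fst d))"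

text \<open>A tangent vector at \<open>p\<close> is the family of its coordinate vectors in all charts
  around \<open>p\<close>, related by the Jacobians of the transition maps.  Entries at other charts are
  set to \<open>0\<close>, so that equality of families is equality of tangent vectors; the vector space
  operations are pointwise.\<close>

type_synonym ('a, 'n) tangent = "('a, 'n) chart \<Rightarrow> real ^ 'n"

definition tangent_space ::
  "('a, 'n::finite) chart set \<Rightarrow> 'a \<Rightarrow> ('a, 'n) tangent set"
  where "tangent_space A p =
    {X. (\<forall>c\<in>A. \<forall>d\<in>A. p \<in> fst c \<longrightarrow> p \<in> fst d \<longrightarrow>
           X d = frechet_derivative (transition c d) (at (snd c p)) (X c)) \<and>
        (\<forall>c. \<not> (c \<in> A \<and> p \<in> fst c) \<longrightarrow> X c = 0)}"

text \<open>The tangent vector \<open>\<partial>/\<partial>x\<^sup>i\<close> at \<open>p\<close> of the chart \<open>c\<close>.\<close>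

definition coord_vector ::
  "('a, 'n::finite) chart set \<Rightarrow> ('a, 'n) chart \<Rightarrow> 'n \<Rightarrow> 'a \<Rightarrow> ('a, 'n) tangent"
  where "coord_vector A c i p =
    (\<lambda>d. if d \<in> A \<and> p \<in> fst d
          then frechet_derivative (transition c d) (at (snd c p)) (axis i 1) else 0)"

type_synonym ('a, 'n) metric = "'a \<Rightarrow> ('a, 'n) tangent \<Rightarrow> ('a, 'n) tangent \<Rightarrow> real"

text \<open>The matrix \<open>g\<^sub>i\<^sub>j\<close> of the metric in the chart \<open>c\<close>, as a function on the image of the chart.\<close>

definition metric_matrix ::
  "('a, 'n::finite) chart set \<Rightarrow> ('a, 'n) metric \<Rightarrow> ('a, 'n) chart \<Rightarrow> real ^ 'n \<Rightarrow> real ^ 'n ^ 'n"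
  where "metric_matrix A g c x =
    (let p = inv_into (fst c) (snd c) x
     in \<chi> i j. g p (coord_vector A c i p) (coord_vector A c j p))"

locale riemannian_manifold = smooth_manifold M A
  for M :: "'a topology" and A :: "('a, 'n::finite) chart set" +
  fixes g :: "('a, 'n) metric"
  assumes metric_sym:
      "p \<in> topspace M \<Longrightarrow> X \<in> tangent_space A p \<Longrightarrow> Y \<in> tangent_space A p \<Longrightarrow> g p X Y = g p Y X"
    and metric_linear:
      "p \<in> topspace M \<Longrightarrow> X \<in> tangent_space A p \<Longrightarrow> Y \<in> tangent_space A p \<Longrightarrow>
       Z \<in> tangent_space A p \<Longrightarrow>
       g p (\<lambda>c. a *\<^sub>R X c + b *\<^sub>R Y c) Z = a * g p X Z + b * g p Y Z"
    and metric_pos: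
      "p \<in> topspace M \<Longrightarrow> X \<in> tangent_space A p \<Longrightarrow> X \<noteq> (\<lambda>_. 0) \<Longrightarrow> 0 < g p X X"
    and metric_smooth:
      "c \<in> A \<Longrightarrow> smooth_on (\<lambda>x. metric_matrix A g c x $ i $ j) (snd c ` fst c)"

text \<open>\<open>christoffel A g c a b k x\<close> is the symbol with upper index \<open>a\<close> and lower indices \<open>b\<close>, \<open>k\<close>
  of the Levi-Civita connection, in the chart \<open>c\<close> at the coordinate point \<open>x\<close>.\<close>

definition christoffel ::
  "('a, 'n::finite) chart set \<Rightarrow> ('a, 'n) metric \<Rightarrow> ('a, 'n) chart \<Rightarrow> 'n \<Rightarrow> 'n \<Rightarrow> 'n
    \<Rightarrow> real ^ 'n \<Rightarrow> real"
  where "christoffel A g c a b k x =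
    (1 / 2) * (\<Sum>l\<in>UNIV. matrix_inv (metric_matrix A g c x) $ a $ l *
      (partial_deriv (axis b 1) (\<lambda>y. metric_matrix A g c y $ l $ k) x
       + partial_deriv (axis k 1) (\<lambda>y. metric_matrix A g c y $ l $ b) x
       - partial_deriv (axis l 1) (\<lambda>y. metric_matrix A g c y $ b $ k) x))"

text \<open>Points of the plane are pairs \<open>(x, y)\<close>; the norm of \<^typ>\<open>real \<times> real\<close> is Euclidean.\<close>

abbreviation d_x :: "(real \<times> real \<Rightarrow> 'w::real_normed_vector) \<Rightarrow> real \<times> real \<Rightarrow> 'w"
  where "d_x \<equiv> partial_deriv (1, 0)"

abbreviation d_y :: "(real \<times> real \<Rightarrow> 'w::real_normed_vector) \<Rightarrow> real \<times> real \<Rightarrow> 'w"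
  where "d_y \<equiv> partial_deriv (0, 1)"

definition laplacian :: "(real \<times> real \<Rightarrow> real) \<Rightarrow> real \<times> real \<Rightarrow> real"
  where "laplacian f z = d_x (d_x f) z + d_y (d_y f) z"

text \<open>The Euler-Lagrange equation of the energy in local coordinates, for classical
  (twice continuously differentiable) maps on \<open>D\<^sub>R\<close>.  Such solutions are smooth by elliptic
  regularity, so requiring smooth maps would give the same class.\<close>

definition harmonic_on_disk ::
  "'a topology \<Rightarrow> ('a, 'n::finite) chart set \<Rightarrow> ('a, 'n) metric \<Rightarrow> real
    \<Rightarrow> (real \<times> real \<Rightarrow> 'a) \<Rightarrow> bool"
  where "harmonic_on_disk M A g R u \<longleftrightarrow>
    continuous_map (top_of_set (ball 0 R)) M u \<and>
    (\<forall>c\<in>A.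
       Ck_on 2 (\<lambda>z. snd c (u z)) {z \<in> ball 0 R. u z \<in> fst c} \<and>
       (\<forall>z \<in> ball 0 R. u z \<in> fst c \<longrightarrow>
         (\<forall>a. laplacian (\<lambda>w. snd c (u w) $ a) z
            + (\<Sum>b\<in>UNIV. \<Sum>k\<in>UNIV. christoffel A g c a b k (snd c (u z)) *
                (d_x (\<lambda>w. snd c (u w) $ b) z * d_x (\<lambda>w. snd c (u w) $ k) z
                 + d_y (\<lambda>w. snd c (u w) $ b) z * d_y (\<lambda>w. snd c (u w) $ k) z)) = 0)))"

text \<open>The tangent vector at \<open>u z\<close> obtained by differentiating \<open>u\<close> at \<open>z\<close> in direction \<open>e\<close>.\<close>

definition map_deriv ::
  "('a, 'n::finite) chart set \<Rightarrow> (real \<times> real \<Rightarrow> 'a) \<Rightarrow> real \<times> real \<Rightarrow> real \<times> real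
    \<Rightarrow> ('a, 'n) tangent"
  where "map_deriv A u e z =
    (\<lambda>c. if c \<in> A \<and> u z \<in> fst c then partial_deriv e (\<lambda>w. snd c (u w)) z else 0)"

definition conformal_at_0 ::
  "('a, 'n::finite) chart set \<Rightarrow> ('a, 'n) metric \<Rightarrow> (real \<times> real \<Rightarrow> 'a) \<Rightarrow> bool"
  where "conformal_at_0 A g u \<longleftrightarrow>
    g (u 0) (map_deriv A u (1, 0) 0) (map_deriv A u (1, 0) 0) =
      g (u 0) (map_deriv A u (0, 1) 0) (map_deriv A u (0, 1) 0) \<and>
    g (u 0) (map_deriv A u (1, 0) 0) (map_deriv A u (0, 1) 0) = 0"

text \<open>The infimum is taken in the extended reals, where the infimum of the empty set is \<open>\<infinity>\<close>.
  In dimension one conformality at \<open>0\<close> forces the derivative at \<open>0\<close> to vanish, so the value is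
  then \<open>\<infinity>\<close> at every nonzero vector.\<close>

definition kobayashi_metric ::
  "'a topology \<Rightarrow> ('a, 'n::finite) chart set \<Rightarrow> ('a, 'n) metric \<Rightarrow> 'a \<Rightarrow> ('a, 'n) tangent \<Rightarrow> ereal"
  where "kobayashi_metric M A g p X =
    (if X = (\<lambda>_. 0) then 0
     else INF \<alpha> \<in> {\<alpha>. 0 < \<alpha> \<and> (\<exists>u. harmonic_on_disk M A g 1 u \<and> conformal_at_0 A g u \<and>
                 u 0 = p \<and> map_deriv A u (1, 0) 0 = (\<lambda>c. X c /\<^sub>R \<alpha>))}. ereal \<alpha>)"

end

theory Submission
  imports Defs
begin

text \<open>It suffices to solve the harmonic map equation in a single chart around \<open>p\<close> with prescribed small
  first derivatives \<open>a, b\<close> at the origin; taking \<open>a\<close> a multiple of \<open>X\<close> and \<open>b\<close> orthogonal to \<open>a\<close> of the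
  same length (possible in dimension at least two) makes the solution conformal at \<open>0\<close>.

  In the chart the equation reads \<open>\<Delta>u = -H (u, u\<^sub>x, u\<^sub>y)\<close> with \<open>H\<close> quadratic in the derivatives. The unknown
  of the fixed point problem is \<open>f = \<Delta>u\<close>, a compactly supported \<open>C\<^sup>1\<close> function: \<open>u\<^sub>x\<close> and \<open>u\<^sub>y\<close> are
  recovered from \<open>f\<close> by the gradient of the Newtonian potential, and \<open>u\<close> by integration along rays. Since
  this operator maps \<open>C\<^sup>1\<close> to \<open>C\<^sup>1\<close> and \<open>H\<close> involves first derivatives only, \<open>f \<mapsto> -\<psi> H (u, u\<^sub>x, u\<^sub>y)\<close> with a cutoff
  \<open>\<psi>\<close> is a contraction of a small ball of \<open>C\<^sup>1\<close> functions, and no Hoelder estimates are needed.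

  The equation in the other charts follows from its weak form \<open>euler_lagrange\<close>, which is manifestly
  invariant because it only involves the metric and a test vector.\<close>

section \<open>The gradient of the Newtonian potential in the plane\<close>

text \<open>The nonlinearity is quadratic in the derivatives, so the unit disk stays fixed and all
  smallness sits in the prescribed derivatives \<open>a\<close> and \<open>b\<close>: for data of
  size \<rho> the right-hand side has size of order \<rho>^2 and its Lipschitz constant is of order
  \<rho>. Dividing \<open>X\<close> by a large \<alpha> is therefore the only scaling in the
  argument, and a single admissible \<alpha> already makes the infimum finite. The usual obstacle is
  that a merely continuous right-hand side need not have a twice differentiable potential. Keeping
  the right-hand side itself in C^1 avoids this: the integral for the gradient is differentiated by
  letting the derivative fall on \<open>f\<close>, never on the kernel, so the second derivatives of
  \<open>u\<close> are bounded integrals of the same kind. The loop closes because differentiating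
  \<open>H\<close> along the jet asks for one derivative of the gradient, which is what these
  integrals provide. Representing \<open>u\<close> this way takes only a curl and a divergence
  identity; the cutoff supplies the compact support that the second one requires.\<close>

definition polar :: "real \<times> real \<Rightarrow> real \<times> real"
  where "polar q = (fst q * cos (snd q), fst q * sin (snd q))"

text \<open>For \<open>k = cos\<close> and \<open>k = sin\<close> and \<open>F\<close> vanishing outside the disk of radius 2, this is, on that disk,
  the gradient of the Newtonian potential of \<open>F\<close>. In polar coordinates around \<open>z\<close> the area element
  cancels the singularity \<open>1 / r\<close> of the kernel.\<close>

definition polar_int :: "(real \<Rightarrow> real) \<Rightarrow> (real \<times> real \<Rightarrow> 'b::banach) \<Rightarrow> real \<times> real \<Rightarrow> 'b"
  where "polar_int k F z =
    (1 / (2 * pi)) *\<^sub>R integral (cbox (0, 0) (4, 2 * pi)) (\<lambda>q. k (snd q) *\<^sub>R F (z - polar q))"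

lemma continuous_on_polar [continuous_intros]:
  fixes f :: "'a::t2_space \<Rightarrow> real \<times> real"
  shows "continuous_on S f \<Longrightarrow> continuous_on S (\<lambda>x. polar (f x))"
  unfolding polar_def by (intro continuous_intros)

lemma norm_polar: "norm (polar q) = \<bar>fst q\<bar>"
proof -
  have "(fst q * cos (snd q))\<^sup>2 + (fst q * sin (snd q))\<^sup>2 = (fst q)\<^sup>2 * ((sin (snd q))\<^sup>2 + (cos (snd q))\<^sup>2)"
    by (simp only: power_mult_distrib distrib_left add.commute)
  then show ?thesis
    by (simp add: polar_def norm_Pair)
qed

lemma polar_integrable:
  fixes F :: "real \<times> real \<Rightarrow> 'b::banach"
  assumes "continuous_on UNIV k" "continuous_on UNIV F"
  shows "(\<lambda>q. k (snd q) *\<^sub>R F (z - polar q)) integrable_on cbox (0, 0) (4, 2 * pi)"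
  by (intro integrable_continuous continuous_intros continuous_on_compose2[OF assms(1)]
      continuous_on_compose2[OF assms(2)]) auto

lemma polar_int_diff:
  fixes F G :: "real \<times> real \<Rightarrow> 'b::banach"
  assumes "continuous_on UNIV k" "continuous_on UNIV F" "continuous_on UNIV G"
  shows "polar_int k (\<lambda>z. F z - G z) z = polar_int k F z - polar_int k G z"
  unfolding polar_int_def scaleR_diff_right[symmetric]
  by (subst integral_diff[symmetric])
    (auto intro!: polar_integrable assms simp: scaleR_diff_right)

text \<open>The domain of integration has area \<open>4 * (2 * pi)\<close>; the prefactor
  \<open>1 / (2 * pi)\<close> leaves the constant 4.\<close>

lemma norm_polar_int_le:
  fixes F :: "real \<times> real \<Rightarrow> 'b::banach"
  assumes k: "continuous_on UNIV k" "\<And>t. \<bar>k t\<bar> \<le> 1"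
    and F: "continuous_on UNIV F" "\<And>z. norm (F z) \<le> B"
  shows "norm (polar_int k F z) \<le> 4 * B"
proof -
  have B: "0 \<le> B" using norm_ge_zero[of "F 0"] F(2)[of 0] by linarith
  have "norm (integral (cbox (0, 0) (4, 2 * pi)) (\<lambda>q. k (snd q) *\<^sub>R F (z - polar q)))
      \<le> integral (cbox (0, 0) (4, 2 * pi :: real)) (\<lambda>q::real \<times> real. B)"
  proof (intro integral_norm_bound_integral polar_integrable k F integrable_const)
    fix q :: "real \<times> real"
    have "norm (k (snd q) *\<^sub>R F (z - polar q)) = \<bar>k (snd q)\<bar> * norm (F (z - polar q))" by simp
    also have "\<dots> \<le> 1 * B" by (intro mult_mono k F) auto
    finally show "norm (k (snd q) *\<^sub>R F (z - polar q)) \<le> B" by simp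
  qed
  also have "\<dots> = 8 * pi * B"
    by (simp add: content_Pair)
  finally show ?thesis
    by (simp add: polar_int_def field_simps)
qed

lemma continuous_on_polar_int:
  fixes F :: "real \<times> real \<Rightarrow> 'b::banach"
  assumes "continuous_on UNIV k" "continuous_on UNIV F"
  shows "continuous_on UNIV (polar_int k F)"
  unfolding polar_int_def
  by (intro continuous_intros integral_continuous_on_param)
    (auto intro!: continuous_intros continuous_on_compose2[OF assms(1)]
      continuous_on_compose2[OF assms(2)] simp: split_beta)

text \<open>All dependence on \<open>z\<close> sits in the argument of \<open>f\<close>, so the
  derivative falls on \<open>f\<close> and the weight stays bounded. The result is again a
  \<open>polar_int\<close>, now with values in bounded linear maps, and the bounds above apply to it
  unchanged.\<close>

lemma has_derivative_polar_int:
  fixes f :: "real \<times> real \<Rightarrow> 'b::banach"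
    and f' :: "real \<times> real \<Rightarrow> (real \<times> real) \<Rightarrow>\<^sub>L 'b"
  assumes k: "continuous_on UNIV k"
    and f: "\<And>z. (f has_derivative blinfun_apply (f' z)) (at z)"
    and f': "continuous_on UNIV f'"
  shows "(polar_int k f has_derivative blinfun_apply (polar_int k f' z)) (at z)"
proof -
  have cf: "continuous_on UNIV f"
    by (intro continuous_at_imp_continuous_on ballI has_derivative_continuous[OF f])
  have "((\<lambda>x. integral (cbox (0,0) (4, 2*pi)) (\<lambda>q. k (snd q) *\<^sub>R f (x - polar q))) has_derivative
      blinfun_apply (integral (cbox (0,0) (4, 2*pi)) (\<lambda>q. k (snd q) *\<^sub>R f' (z - polar q)))) (at z within UNIV)"
  proof (rule leibniz_rule)
    show "((\<lambda>x. k (snd t) *\<^sub>R f (x - polar t)) has_derivative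
        blinfun_apply (k (snd t) *\<^sub>R f' (x - polar t))) (at x within UNIV)" for x t
      by (auto intro!: derivative_eq_intros has_derivative_compose[OF _ f] simp: blinfun.bilinear_simps)
  qed (auto intro!: polar_integrable k cf continuous_intros continuous_on_compose2[OF k]
      continuous_on_compose2[OF f'] simp: split_beta)
  then have "((\<lambda>x. (1 / (2 * pi)) *\<^sub>R integral (cbox (0,0) (4, 2*pi)) (\<lambda>q. k (snd q) *\<^sub>R f (x - polar q))) has_derivative
      (\<lambda>h. (1 / (2 * pi)) *\<^sub>R blinfun_apply (integral (cbox (0,0) (4, 2*pi)) (\<lambda>q. k (snd q) *\<^sub>R f' (z - polar q))) h)) (at z)"
    by (rule has_derivative_scaleR_right)
  then show ?thesis
    by (simp only: polar_int_def[abs_def] scaleR_blinfun.rep_eq)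
qed

lemma polar_int_apply:
  fixes F :: "real \<times> real \<Rightarrow> (real \<times> real) \<Rightarrow>\<^sub>L 'b::banach"
  assumes "continuous_on UNIV k" "continuous_on UNIV F"
  shows "blinfun_apply (polar_int k F z) h =
    (1 / (2 * pi)) *\<^sub>R integral (cbox (0, 0) (4, 2 * pi)) (\<lambda>q. k (snd q) *\<^sub>R blinfun_apply (F (z - polar q)) h)"
  by (simp add: polar_int_def blinfun.bilinear_simps
      blinfun_apply_integral[OF polar_integrable[OF assms]])

context
  fixes f :: "real \<times> real \<Rightarrow> 'b::banach"
    and f' :: "real \<times> real \<Rightarrow> (real \<times> real) \<Rightarrow>\<^sub>L 'b"
  assumes f: "\<And>z. (f has_derivative blinfun_apply (f' z)) (at z)"
    and f': "continuous_on UNIV f'"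
begin

text \<open>In polar coordinates around \<open>z\<close> the integrand is a multiple of the angular derivative of \<open>f\<close>.\<close>

lemma polar_int_curl:
  "blinfun_apply (polar_int cos f' z) (0, 1) = blinfun_apply (polar_int sin f' z) (1, 0)"
proof -
  let ?g = "\<lambda>q. blinfun_apply (f' (z - polar q)) (- sin (snd q), cos (snd q))"
  have cg: "continuous_on S ?g" for S
    by (intro continuous_intros continuous_on_compose2[OF f']) auto
  have inner: "integral (cbox 0 (2 * pi)) (\<lambda>t. ?g (r, t)) = 0" for r
  proof (cases "r = 0")
    \<comment> \<open>For radius 0 the angular derivative of \<open>f\<close> is 0 and says nothing
      about the integrand. That integrand is then the fixed linear map \<open>f' z\<close> applied
      to the velocity of the unit circle, which closes up.\<close>
    case True
    have "((\<lambda>t. ?g (r, t)) has_integral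
        blinfun_apply (f' z) (cos (2 * pi), sin (2 * pi)) - blinfun_apply (f' z) (cos 0, sin 0)) {0..2 * pi}"
      using True by (intro fundamental_theorem_of_calculus)
        (auto simp: polar_def has_vector_derivative_def zero_prod_def[symmetric] blinfun.scaleR_right[symmetric]
          intro!: derivative_eq_intros)
    then show ?thesis by (simp add: has_integral_integral integral_unique)
  next
    case False
    have "((\<lambda>t. - r *\<^sub>R ?g (r, t)) has_integral
        f (z - polar (r, 2 * pi)) - f (z - polar (r, 0))) {0..2 * pi}"
    proof (intro fundamental_theorem_of_calculus)
      fix t :: real
      have "((\<lambda>t. f (z - polar (r, t))) has_derivative
          (\<lambda>h. blinfun_apply (f' (z - polar (r, t))) (- (h * (r * - sin t)), - (h * (r * cos t))))) (at t within {0..2*pi})"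
        unfolding polar_def
        by (rule has_derivative_compose[OF _ f]) (auto intro!: derivative_eq_intros simp: prod_eq_iff)
      moreover have "blinfun_apply (f' (z - polar (r, t))) (- (h * (r * - sin t)), - (h * (r * cos t)))
          = h *\<^sub>R (- r *\<^sub>R ?g (r, t))" for h
        by (simp add: blinfun.scaleR_right[symmetric] blinfun.minus_right[symmetric] algebra_simps)
      ultimately show "((\<lambda>t. f (z - polar (r, t))) has_vector_derivative - r *\<^sub>R ?g (r, t))
          (at t within {0..2 * pi})"
        by (simp add: has_vector_derivative_def)
    qed simp
    then have "((\<lambda>t. - r *\<^sub>R ?g (r, t)) has_integral 0) {0..2 * pi}"
      by (simp add: polar_def)
    then have "((\<lambda>t. (- 1 / r) *\<^sub>R (- r *\<^sub>R ?g (r, t))) has_integral (- 1 / r) *\<^sub>R 0) {0..2 * pi}"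
      by (rule has_integral_cmul)
    then show ?thesis using False by (simp add: integral_unique)
  qed
  have "blinfun_apply (polar_int cos f' z) (0, 1) - blinfun_apply (polar_int sin f' z) (1, 0) =
     (1 / (2 * pi)) *\<^sub>R integral (cbox (0, 0) (4, 2 * pi)) ?g"
    unfolding polar_int_apply[OF continuous_on_cos[OF continuous_on_id] f'] polar_int_apply[OF continuous_on_sin[OF continuous_on_id] f']
      scaleR_diff_right[symmetric]
    apply (subst integral_diff[symmetric])
    subgoal by (intro integrable_continuous continuous_intros continuous_on_compose2[OF f']) auto
    subgoal by (intro integrable_continuous continuous_intros continuous_on_compose2[OF f']) auto
    by (simp add: blinfun.scaleR_right[symmetric] blinfun.diff_right[symmetric] blinfun.add_right[symmetric])
  also have "integral (cbox (0, 0) (4, 2 * pi)) ?g = 0"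
    by (subst integral_prod_continuous[OF cg]) (simp only: inner integral_0)
  finally show ?thesis by simp
qed

text \<open>Here the integrand is minus the radial derivative, so the inner integral is the value at the
  centre minus the value on the circle of radius 4.\<close>

lemma polar_int_divergence:
  assumes z: "norm z \<le> 2" and supp: "\<And>w. 2 \<le> norm w \<Longrightarrow> f w = 0"
  shows "blinfun_apply (polar_int cos f' z) (1, 0) + blinfun_apply (polar_int sin f' z) (0, 1) = f z"
proof -
  let ?g = "\<lambda>q. blinfun_apply (f' (z - polar q)) (cos (snd q), sin (snd q))"
  have cg: "continuous_on S ?g" for S
    by (intro continuous_intros continuous_on_compose2[OF f']) auto
  have inner: "integral (cbox 0 4) (\<lambda>r. ?g (r, t)) = f z" for t
  proof -
    have "((\<lambda>r. - ?g (r, t)) has_integral f (z - polar (4, t)) - f (z - polar (0, t))) {0..4}"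
    proof (intro fundamental_theorem_of_calculus)
      fix r :: real
      have "((\<lambda>r. f (z - polar (r, t))) has_derivative
          (\<lambda>h. blinfun_apply (f' (z - polar (r, t))) (- (h * cos t), - (h * sin t)))) (at r within {0..4})"
        unfolding polar_def
        by (rule has_derivative_compose[OF _ f]) (auto intro!: derivative_eq_intros simp: prod_eq_iff)
      moreover have "blinfun_apply (f' (z - polar (r, t))) (- (h * cos t), - (h * sin t))
          = h *\<^sub>R (- ?g (r, t))" for h
        by (simp add: blinfun.scaleR_right[symmetric] blinfun.minus_right[symmetric])
      ultimately show "((\<lambda>r. f (z - polar (r, t))) has_vector_derivative - ?g (r, t))
          (at r within {0..4})"
        by (simp add: has_vector_derivative_def)
    qed simp
    \<comment> \<open>A circle of radius 4 around a point of the disk of radius 2 avoids the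
      interior of that disk. This is the origin of the radius 4 in \<open>polar_int\<close>.\<close>
    moreover have "f (z - polar (4, t)) = 0"
    proof (rule supp)
      have "norm (polar (4, t)) - norm z \<le> norm (z - polar (4, t))"
        by (metis norm_minus_commute norm_triangle_ineq2)
      then show "2 \<le> norm (z - polar (4, t))" using z by (simp add: norm_polar)
    qed
    ultimately have "((\<lambda>r. - ?g (r, t)) has_integral - f z) {0..4}"
      by (simp add: polar_def zero_prod_def[symmetric])
    from has_integral_neg[OF this] show ?thesis by (simp add: integral_unique)
  qed
  have "blinfun_apply (polar_int cos f' z) (1, 0) + blinfun_apply (polar_int sin f' z) (0, 1) =
     (1 / (2 * pi)) *\<^sub>R integral (cbox (0, 0) (4, 2 * pi)) ?g"
    unfolding polar_int_apply[OF continuous_on_cos[OF continuous_on_id] f'] polar_int_apply[OF continuous_on_sin[OF continuous_on_id] f']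
      scaleR_add_right[symmetric]
    apply (subst integral_add[symmetric])
    subgoal by (intro integrable_continuous continuous_intros continuous_on_compose2[OF f']) auto
    subgoal by (intro integrable_continuous continuous_intros continuous_on_compose2[OF f']) auto
    by (simp add: blinfun.scaleR_right[symmetric] blinfun.diff_right[symmetric] blinfun.add_right[symmetric])
  also have "integral (cbox (0, 0) (4, 2 * pi)) ?g =
      integral (cbox 0 4) (\<lambda>r. integral (cbox 0 (2 * pi)) (\<lambda>t. ?g (r, t)))"
    by (rule integral_prod_continuous[OF cg])
  \<comment> \<open>The radial integral has to be the inner one: the integrand is an exact
    derivative along each ray of fixed angle.\<close>
  also have "\<dots> = integral (cbox 0 (2 * pi)) (\<lambda>t. integral (cbox 0 4) (\<lambda>r. ?g (r, t)))"
    by (rule integral_swap_continuous) (simp add: split_beta cg)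
  also have "\<dots> = (2 * pi) *\<^sub>R f z"
    by (simp only: inner) simp
  finally show ?thesis by simp
qed

end

section \<open>Primitives of closed one-forms in the plane\<close>

definition pd_blinfun :: "'b \<Rightarrow> 'b \<Rightarrow> (real \<times> real) \<Rightarrow>\<^sub>L 'b::real_normed_vector"
  where "pd_blinfun a b = (blinfun_scaleR_left a o\<^sub>L fst_blinfun) + (blinfun_scaleR_left b o\<^sub>L snd_blinfun)"

lemma pd_blinfun_apply [simp]: "blinfun_apply (pd_blinfun a b) h = fst h *\<^sub>R a + snd h *\<^sub>R b"
  by (simp add: pd_blinfun_def blinfun.bilinear_simps)

lemma continuous_on_pd_blinfun [continuous_intros]:
  "continuous_on S f \<Longrightarrow> continuous_on S g \<Longrightarrow> continuous_on S (\<lambda>x. pd_blinfun (f x) (g x))"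
  unfolding pd_blinfun_def
  by (intro continuous_intros bounded_linear.continuous_on[OF bounded_linear_blinfun_scaleR_left])

lemma norm_pd_blinfun_le: "norm (pd_blinfun a b) \<le> norm a + norm b"
proof (rule norm_blinfun_bound)
  fix h :: "real \<times> real"
  have "norm (fst h *\<^sub>R a + snd h *\<^sub>R b) \<le> \<bar>fst h\<bar> * norm a + \<bar>snd h\<bar> * norm b"
    by (metis norm_scaleR norm_triangle_ineq)
  also have "\<dots> \<le> norm h * norm a + norm h * norm b"
    by (intro add_mono mult_right_mono) (metis norm_fst_le norm_snd_le real_norm_def prod.collapse norm_ge_zero)+
  finally show "norm (blinfun_apply (pd_blinfun a b) h) \<le> (norm a + norm b) * norm h"
    by (simp add: algebra_simps)
qed simp

lemma blinfun_apply_real_pair: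
  "blinfun_apply A h = fst h *\<^sub>R blinfun_apply A (1, 0) + snd h *\<^sub>R blinfun_apply A (0, 1)"
  for h :: "real \<times> real"
  unfolding blinfun.scaleR_right[symmetric] blinfun.add_right[symmetric] by simp

text \<open>The one-form \<open>P dx + Q dy\<close> integrated along the segment from the origin to
  \<open>z\<close>: the candidate of the Poincare lemma for a function with partial derivatives
  \<open>P\<close> and \<open>Q\<close>.\<close>

definition line_int :: "(real \<times> real \<Rightarrow> 'b) \<Rightarrow> (real \<times> real \<Rightarrow> 'b) \<Rightarrow> real \<times> real \<Rightarrow> 'b::banach"
  where "line_int P Q z = integral (cbox 0 1) (\<lambda>t. fst z *\<^sub>R P (t *\<^sub>R z) + snd z *\<^sub>R Q (t *\<^sub>R z))"

lemma line_int_integrable: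
  fixes P Q :: "real \<times> real \<Rightarrow> 'b::banach"
  assumes "continuous_on UNIV P" "continuous_on UNIV Q"
  shows "(\<lambda>t. fst z *\<^sub>R P (t *\<^sub>R z) + snd z *\<^sub>R Q (t *\<^sub>R z)) integrable_on cbox (0::real) 1"
  by (intro integrable_continuous continuous_intros continuous_on_compose2[OF assms(1)]
      continuous_on_compose2[OF assms(2)]) auto

lemma line_int_0 [simp]: "line_int P Q 0 = 0"
  by (simp add: line_int_def)

lemma line_int_diff:
  fixes P Q :: "real \<times> real \<Rightarrow> 'b::banach"
  assumes "continuous_on UNIV P1" "continuous_on UNIV Q1" "continuous_on UNIV P2" "continuous_on UNIV Q2"
  shows "line_int (\<lambda>z. P1 z - P2 z) (\<lambda>z. Q1 z - Q2 z) z = line_int P1 Q1 z - line_int P2 Q2 z"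
  unfolding line_int_def
  by (subst integral_diff[OF line_int_integrable[OF assms(1,2)] line_int_integrable[OF assms(3,4)], symmetric])
    (simp add: algebra_simps)

lemma norm_line_int_le:
  fixes P Q :: "real \<times> real \<Rightarrow> 'b::banach"
  assumes "continuous_on UNIV P" "continuous_on UNIV Q"
    and B: "\<And>z. norm (P z) \<le> B" "\<And>z. norm (Q z) \<le> B"
  shows "norm (line_int P Q z) \<le> 2 * norm z * B"
proof -
  have "norm (line_int P Q z) \<le> integral (cbox 0 1) (\<lambda>t::real. 2 * norm z * B)"
    unfolding line_int_def
  proof (intro integral_norm_bound_integral line_int_integrable assms integrable_const)
    fix t :: real
    have B0: "0 \<le> B" using norm_ge_zero[of "P 0"] B(1)[of 0] by linarith
    have "norm (fst z *\<^sub>R P (t *\<^sub>R z) + snd z *\<^sub>R Q (t *\<^sub>R z)) \<le> \<bar>fst z\<bar> * norm (P (t *\<^sub>R z)) + \<bar>snd z\<bar> * norm (Q (t *\<^sub>R z))"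
      by (metis norm_scaleR norm_triangle_ineq)
    also have "\<dots> \<le> norm z * B + norm z * B"
      by (intro add_mono mult_mono B) (use norm_fst_le[of "fst z" "snd z"] norm_snd_le[of "snd z" "fst z"] in auto)
    finally show "norm (fst z *\<^sub>R P (t *\<^sub>R z) + snd z *\<^sub>R Q (t *\<^sub>R z)) \<le> 2 * norm z * B" by (simp add: mult_ac)
  qed
  then show ?thesis by simp
qed

lemma has_derivative_line_int:
  fixes P Q :: "real \<times> real \<Rightarrow> 'b::banach"
  assumes P: "\<And>z. (P has_derivative blinfun_apply (P' z)) (at z)"
    and Q: "\<And>z. (Q has_derivative blinfun_apply (Q' z)) (at z)"
    and P': "continuous_on UNIV P'" and Q': "continuous_on UNIV Q'"
    and curl: "\<And>z. blinfun_apply (P' z) (0, 1) = blinfun_apply (Q' z) (1, 0)"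
  shows "(line_int P Q has_derivative blinfun_apply (pd_blinfun (P z) (Q z))) (at z)"
proof -
  have cP: "continuous_on UNIV P" and cQ: "continuous_on UNIV Q"
    by (intro continuous_at_imp_continuous_on ballI has_derivative_continuous[OF P] has_derivative_continuous[OF Q])+
  let ?D = "\<lambda>z t. pd_blinfun (P (t *\<^sub>R z)) (Q (t *\<^sub>R z)) + (t * fst z) *\<^sub>R P' (t *\<^sub>R z) + (t * snd z) *\<^sub>R Q' (t *\<^sub>R z)"
  have cD: "continuous_on S (?D z)" for S z
    by (intro continuous_intros continuous_on_compose2[OF cP] continuous_on_compose2[OF cQ]
        continuous_on_compose2[OF P'] continuous_on_compose2[OF Q']) auto
  have "((\<lambda>z. integral (cbox 0 1) (\<lambda>t. fst z *\<^sub>R P (t *\<^sub>R z) + snd z *\<^sub>R Q (t *\<^sub>R z))) has_derivative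
      blinfun_apply (integral (cbox 0 1) (?D z))) (at z within UNIV)"
  proof (rule leibniz_rule)
    fix x :: "real \<times> real" and t :: real
    have "((\<lambda>x. P (t *\<^sub>R x)) has_derivative (\<lambda>h. blinfun_apply (P' (t *\<^sub>R x)) (t *\<^sub>R h))) (at x)"
      "((\<lambda>x. Q (t *\<^sub>R x)) has_derivative (\<lambda>h. blinfun_apply (Q' (t *\<^sub>R x)) (t *\<^sub>R h))) (at x)"
      by (rule has_derivative_compose[OF _ P] has_derivative_compose[OF _ Q], auto intro!: derivative_eq_intros)+
    then have "((\<lambda>x. fst x *\<^sub>R P (t *\<^sub>R x) + snd x *\<^sub>R Q (t *\<^sub>R x)) has_derivative
        (\<lambda>h. (fst x *\<^sub>R blinfun_apply (P' (t *\<^sub>R x)) (t *\<^sub>R h) + fst h *\<^sub>R P (t *\<^sub>R x)) +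
          (snd x *\<^sub>R blinfun_apply (Q' (t *\<^sub>R x)) (t *\<^sub>R h) + snd h *\<^sub>R Q (t *\<^sub>R x)))) (at x)"
      by (intro has_derivative_add has_derivative_scaleR has_derivative_fst has_derivative_snd has_derivative_ident)
    moreover have "(\<lambda>h. (fst x *\<^sub>R blinfun_apply (P' (t *\<^sub>R x)) (t *\<^sub>R h) + fst h *\<^sub>R P (t *\<^sub>R x)) +
          (snd x *\<^sub>R blinfun_apply (Q' (t *\<^sub>R x)) (t *\<^sub>R h) + snd h *\<^sub>R Q (t *\<^sub>R x))) = blinfun_apply (?D x t)"
      by (auto simp: blinfun.bilinear_simps mult.commute)
    ultimately show "((\<lambda>x. fst x *\<^sub>R P (t *\<^sub>R x) + snd x *\<^sub>R Q (t *\<^sub>R x)) has_derivative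
        blinfun_apply (?D x t)) (at x within UNIV)" by simp
  next
    show "continuous_on (UNIV \<times> cbox 0 1) (\<lambda>(x, t). ?D x t)"
      unfolding split_beta
      by (intro continuous_intros continuous_on_compose2[OF cP] continuous_on_compose2[OF cQ]
        continuous_on_compose2[OF P'] continuous_on_compose2[OF Q']) auto
  qed (use convex_UNIV in \<open>simp_all only: line_int_integrable[OF cP cQ] UNIV_I\<close>)
  \<comment> \<open>Closedness exchanges the mixed partial derivatives, so that
    \<open>?D z t\<close> applied to \<open>h\<close> is the derivative in \<open>t\<close> of
    \<open>t\<close> times the form at \<open>t *\<^sub>R z\<close> applied to \<open>h\<close>.
    Only the endpoint \<open>t = 1\<close> contributes.\<close>
  moreover have "integral (cbox 0 1) (?D z) = pd_blinfun (P z) (Q z)"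
  proof (rule blinfun_eqI)
    fix h :: "real \<times> real"
    have "((\<lambda>t. blinfun_apply (?D z t) h) has_integral
        1 *\<^sub>R blinfun_apply (pd_blinfun (P (1 *\<^sub>R z)) (Q (1 *\<^sub>R z))) h
        - 0 *\<^sub>R blinfun_apply (pd_blinfun (P (0 *\<^sub>R z)) (Q (0 *\<^sub>R z))) h) {0..1}"
    proof (intro fundamental_theorem_of_calculus)
      fix t :: real
      have dP: "((\<lambda>t. P (t *\<^sub>R z)) has_derivative (\<lambda>k. blinfun_apply (P' (t *\<^sub>R z)) (k *\<^sub>R z))) (at t within {0..1})"
        and dQ: "((\<lambda>t. Q (t *\<^sub>R z)) has_derivative (\<lambda>k. blinfun_apply (Q' (t *\<^sub>R z)) (k *\<^sub>R z))) (at t within {0..1})"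
        by (rule has_derivative_compose[OF _ P] has_derivative_compose[OF _ Q], auto intro!: derivative_eq_intros)+
      have "((\<lambda>t. t *\<^sub>R (fst h *\<^sub>R P (t *\<^sub>R z) + snd h *\<^sub>R Q (t *\<^sub>R z))) has_derivative
         (\<lambda>k. t *\<^sub>R (fst h *\<^sub>R blinfun_apply (P' (t *\<^sub>R z)) (k *\<^sub>R z) + snd h *\<^sub>R blinfun_apply (Q' (t *\<^sub>R z)) (k *\<^sub>R z))
           + k *\<^sub>R (fst h *\<^sub>R P (t *\<^sub>R z) + snd h *\<^sub>R Q (t *\<^sub>R z)))) (at t within {0..1})"
        by (intro has_derivative_scaleR has_derivative_ident has_derivative_add has_derivative_scaleR_right dP dQ)
      moreover have "(\<lambda>k. t *\<^sub>R (fst h *\<^sub>R blinfun_apply (P' (t *\<^sub>R z)) (k *\<^sub>R z) + snd h *\<^sub>R blinfun_apply (Q' (t *\<^sub>R z)) (k *\<^sub>R z))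
           + k *\<^sub>R (fst h *\<^sub>R P (t *\<^sub>R z) + snd h *\<^sub>R Q (t *\<^sub>R z))) = (\<lambda>k. k *\<^sub>R blinfun_apply (?D z t) h)"
        using curl[of "t *\<^sub>R z"]
        by (simp add: blinfun.bilinear_simps blinfun_apply_real_pair[of _ z] blinfun_apply_real_pair[of _ h] algebra_simps)
      ultimately show "((\<lambda>t. t *\<^sub>R blinfun_apply (pd_blinfun (P (t *\<^sub>R z)) (Q (t *\<^sub>R z))) h) has_vector_derivative
          blinfun_apply (?D z t) h) (at t within {0..1})"
        by (simp add: has_vector_derivative_def)
    qed simp
    moreover have "?D z integrable_on cbox 0 1" by (intro integrable_continuous cD)
    ultimately show "blinfun_apply (integral (cbox 0 1) (?D z)) h = blinfun_apply (pd_blinfun (P z) (Q z)) h"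
      by (simp add: blinfun_apply_integral integral_unique)
  qed
  ultimately show ?thesis
    by (simp add: line_int_def[abs_def])
qed

text \<open>The function vanishes already from radius \<open>3/2\<close> on, strictly inside the
  disk of radius 2, so that two overlapping open sets cover the plane in
  \<open>local_solution\<close>. Class C^1 is the regularity of the functions in the fixed point
  problem.\<close>

lemma ex_cutoff:
  obtains \<psi> :: "real \<times> real \<Rightarrow> real" and \<psi>' K where
    "\<And>z. (\<psi> has_derivative blinfun_apply (\<psi>' z)) (at z)" "continuous_on UNIV \<psi>'"
    "\<And>z. \<bar>\<psi> z\<bar> \<le> 1" "\<And>z. norm z \<le> 1 \<Longrightarrow> \<psi> z = 1"
    "\<And>z. 3/2 \<le> norm z \<Longrightarrow> \<psi> z = 0" "\<And>z. 3/2 \<le> norm z \<Longrightarrow> \<psi>' z = 0"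
    "\<And>z. norm (\<psi>' z) \<le> K"
proof -
  \<comment> \<open>The truncated square is a simple C^1 function that is 0 on the negative
    half-line and 1 at 1.\<close>
  define m :: "real \<Rightarrow> real" where "m t = (max 0 t)\<^sup>2" for t
  have m: "(m has_real_derivative 2 * max 0 t) (at t)" for t
  proof (cases "t = 0")
    case True
    have "((\<lambda>h. m h / h) \<longlongrightarrow> 0) (at 0)"
    proof (rule tendsto_rabs_zero_cancel, rule tendsto_sandwich[of "\<lambda>_. 0" _ _ "\<lambda>h. \<bar>h\<bar>"])
      show "\<forall>\<^sub>F n in at 0. \<bar>m n / n\<bar> \<le> \<bar>n\<bar>"
        by (auto simp: m_def max_def power2_eq_square intro!: always_eventually)
    qed (auto intro!: tendsto_eq_intros)
    then show ?thesis using True by (simp add: DERIV_def) (simp add: m_def)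
  next
    case False
    show ?thesis
    proof (cases "t < 0")
      case True
      then have "eventually (\<lambda>x. x < 0) (nhds t)" using eventually_nhds_in_open[OF open_lessThan, of t 0] by simp
      then have "eventually (\<lambda>x. m x = 0) (nhds t)"
        by eventually_elim (auto simp: m_def max_def)
      then show ?thesis using True by (subst DERIV_cong_ev[OF refl _ refl, of _ "\<lambda>_. 0"]) auto
    next
      case F: False
      then have "eventually (\<lambda>x. x > 0) (nhds t)" using False eventually_nhds_in_open[OF open_greaterThan, of t 0] by simp
      then have "eventually (\<lambda>x. m x = x\<^sup>2) (nhds t)"
        by eventually_elim (auto simp: m_def max_def)
      then show ?thesis using False F
        by (subst DERIV_cong_ev[OF refl _ refl, of _ "\<lambda>x. x\<^sup>2"]) (auto intro!: derivative_eq_intros simp: max_def)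
    qed
  qed
  \<comment> \<open>On the unit disk the inner term is 0 and \<open>m 1 = 1\<close>. Once
    \<open>z \<bullet> z\<close> is at least 2 the inner term is at least 1 and the outer argument
    is not positive; \<open>3/2\<close> is a rational bound above the square root of 2.\<close>
  define \<psi> where "\<psi> z = m (1 - m (z \<bullet> z - 1))" for z :: "real \<times> real"
  define c where "c z = 2 * max 0 (1 - m (z \<bullet> z - 1)) * - (2 * max 0 (z \<bullet> z - 1) * 2)" for z :: "real \<times> real"
  define \<psi>' where "\<psi>' z = c z *\<^sub>R blinfun_inner_right z" for z
  have d: "(\<psi> has_derivative blinfun_apply (\<psi>' z)) (at z)" for z
  proof -
    have "((\<lambda>z. m (z \<bullet> z - 1)) has_derivative (\<lambda>h. 2 * max 0 (z \<bullet> z - 1) * (2 * (z \<bullet> h)))) (at z)"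
      by (rule has_derivative_compose[OF _ m[unfolded has_field_derivative_def], THEN has_derivative_eq_rhs])
        (auto intro!: derivative_eq_intros simp: inner_commute)
    from has_derivative_diff[OF has_derivative_const[of 1] this]
    show ?thesis unfolding \<psi>_def[abs_def]
      by (rule has_derivative_compose[OF _ m[unfolded has_field_derivative_def], THEN has_derivative_eq_rhs])
        (auto simp: \<psi>'_def c_def blinfun.bilinear_simps algebra_simps)
  qed
  have cm: "continuous_on UNIV m"
    by (intro continuous_at_imp_continuous_on ballI DERIV_isCont[OF m])
  have cont: "continuous_on S \<psi>'" for S
    unfolding \<psi>'_def[abs_def] c_def
    by (intro continuous_intros continuous_on_compose2[OF cm]
        bounded_linear.continuous_on[OF bounded_linear_blinfun_inner_right]) auto
  have big: "2 \<le> z \<bullet> z" if "3/2 \<le> norm z" for z :: "real \<times> real"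
  proof -
    have "(3/2)\<^sup>2 \<le> (norm z)\<^sup>2" by (rule power_mono[OF that]) simp
    then have "9 / 4 \<le> z \<bullet> z" by (simp only: power2_norm_eq_inner power_divide) simp
    then show ?thesis by linarith
  qed
  have m1: "1 \<le> m (z \<bullet> z - 1)" if "3/2 \<le> norm z" for z :: "real \<times> real"
    using big[OF that] by (simp add: m_def)
  have z0: "\<psi> z = 0" "\<psi>' z = 0" if "3/2 \<le> norm z" for z
  proof -
    have "max 0 (1 - m (z \<bullet> z - 1)) = 0" using m1[OF that] by simp
    then show "\<psi> z = 0" "\<psi>' z = 0"
      by (simp_all only: \<psi>_def m_def[of "1 - _"] \<psi>'_def c_def) simp_all
  qed
  have "compact (\<psi>' ` cball 0 2)" by (intro compact_continuous_image cont compact_cball)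
  then obtain K where K: "\<And>z. z \<in> cball 0 2 \<Longrightarrow> norm (\<psi>' z) \<le> K"
    by (meson bounded_iff compact_imp_bounded image_eqI)
  show ?thesis
  proof
    show "norm (\<psi>' z) \<le> max K 0" for z
      using K[of z] z0(2)[of z] by (cases "norm z \<le> 2") auto
    show "\<psi> z = 1" if "norm z \<le> 1" for z
    proof -
      have "(norm z)\<^sup>2 \<le> 1" using that by (simp add: power_le_one)
      then show ?thesis by (simp add: \<psi>_def m_def power2_norm_eq_inner)
    qed
    show "\<bar>\<psi> z\<bar> \<le> 1" for z
      by (simp add: \<psi>_def m_def power_le_one)
  qed (use d cont z0 in auto)
qed

section \<open>The jet of the potential and its C^1 bounds\<close>

definition triple_blinfun ::
    "'x::real_normed_vector \<Rightarrow>\<^sub>L 'a::real_normed_vector \<Rightarrow> 'x \<Rightarrow>\<^sub>L 'b::real_normed_vector \<Rightarrow> 'x \<Rightarrow>\<^sub>L 'c::real_normed_vector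
      \<Rightarrow> 'x \<Rightarrow>\<^sub>L ('a \<times> 'b \<times> 'c)"
  where "triple_blinfun A B C =
    (Blinfun (\<lambda>x. (x, 0, 0)) o\<^sub>L A) + (Blinfun (\<lambda>x. (0, x, 0)) o\<^sub>L B) + (Blinfun (\<lambda>x. (0, 0, x)) o\<^sub>L C)"

lemma triple_blinfun_apply [simp]:
  "blinfun_apply (triple_blinfun A B C) h = (blinfun_apply A h, blinfun_apply B h, blinfun_apply C h)"
  unfolding triple_blinfun_def
  by (simp add: blinfun.bilinear_simps bounded_linear_Blinfun_apply bounded_linear_Pair
      bounded_linear_zero bounded_linear_ident)

lemma continuous_on_blinfun_compose [continuous_intros]:
  "continuous_on S f \<Longrightarrow> continuous_on S g \<Longrightarrow> continuous_on S (\<lambda>x. f x o\<^sub>L g x)"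
  by (rule bounded_bilinear.continuous_on[OF bounded_bilinear_blinfun_compose])

lemma continuous_on_triple_blinfun [continuous_intros]:
  "continuous_on S f \<Longrightarrow> continuous_on S g \<Longrightarrow> continuous_on S h \<Longrightarrow>
    continuous_on S (\<lambda>x. triple_blinfun (f x) (g x) (h x))"
  unfolding triple_blinfun_def by (intro continuous_intros)

lemma norm_triple_le: "norm (x, y, z) \<le> norm x + norm y + norm z"
  using norm_Pair_le[of x "(y, z)"] norm_Pair_le[of y z] by linarith

lemma norm_triple_blinfun_le: "norm (triple_blinfun A B C) \<le> norm A + norm B + norm C"
proof (rule norm_blinfun_bound)
  fix h
  have "norm (blinfun_apply (triple_blinfun A B C) h)
      \<le> norm (blinfun_apply A h) + norm (blinfun_apply B h) + norm (blinfun_apply C h)"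
    by (simp add: norm_triple_le)
  also have "\<dots> \<le> norm A * norm h + norm B * norm h + norm C * norm h"
    by (intro add_mono norm_blinfun)
  finally show "norm (blinfun_apply (triple_blinfun A B C) h) \<le> (norm A + norm B + norm C) * norm h"
    by (simp add: algebra_simps)
qed simp

text \<open>Adding a constant to a gradient field changes neither its curl nor its divergence, so
  its value at the origin can be prescribed as \<open>a\<close>.\<close>

definition grad_int :: "(real \<Rightarrow> real) \<Rightarrow> 'b \<Rightarrow> (real \<times> real \<Rightarrow> 'b::banach) \<Rightarrow> real \<times> real \<Rightarrow> 'b"
  where "grad_int k a f z = a + (polar_int k f z - polar_int k f 0)"

text \<open>The triple \<open>(u, u\<^sub>x, u\<^sub>y)\<close> with \<open>\<Delta>u = f\<close> on the disk of radius 2, normalised to \<open>(0, a, b)\<close> at the origin.\<close>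

definition jet :: "'b \<Rightarrow> 'b \<Rightarrow> (real \<times> real \<Rightarrow> 'b::banach) \<Rightarrow> real \<times> real \<Rightarrow> 'b \<times> 'b \<times> 'b"
  where "jet a b f z =
    (line_int (grad_int cos a f) (grad_int sin b f) z, grad_int cos a f z, grad_int sin b f z)"

definition jet_deriv :: "'b \<Rightarrow> 'b \<Rightarrow> (real \<times> real \<Rightarrow> 'b::banach) \<Rightarrow> (real \<times> real \<Rightarrow> (real \<times> real) \<Rightarrow>\<^sub>L 'b)
    \<Rightarrow> real \<times> real \<Rightarrow> (real \<times> real) \<Rightarrow>\<^sub>L ('b \<times> 'b \<times> 'b)"
  where "jet_deriv a b f f' z =
    triple_blinfun (pd_blinfun (grad_int cos a f z) (grad_int sin b f z)) (polar_int cos f' z) (polar_int sin f' z)"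

lemma continuous_cos_sin: "continuous_on UNIV (cos :: real \<Rightarrow> real)" "continuous_on UNIV (sin :: real \<Rightarrow> real)"
  by (intro continuous_intros)+

lemma continuous_on_grad_int:
  "continuous_on UNIV k \<Longrightarrow> continuous_on UNIV f \<Longrightarrow> continuous_on UNIV (grad_int k a f)"
  unfolding grad_int_def[abs_def] by (intro continuous_intros continuous_on_polar_int)

lemma norm_grad_int_le:
  assumes "continuous_on UNIV k" "\<And>t. \<bar>k t\<bar> \<le> 1" "continuous_on UNIV f" "\<And>z. norm (f z) \<le> B" "norm a \<le> B"
  shows "norm (grad_int k a f z) \<le> 9 * B"
proof -
  have "norm (grad_int k a f z) \<le> norm a + (norm (polar_int k f z) + norm (polar_int k f 0))"
    unfolding grad_int_def
    using norm_triangle_ineq[of a "polar_int k f z - polar_int k f 0"] norm_triangle_ineq4[of "polar_int k f z" "polar_int k f 0"]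
    by linarith
  then show ?thesis
    using norm_polar_int_le[OF assms(1-4), of z] norm_polar_int_le[OF assms(1-4), of 0] assms(5) by linarith
qed

lemma has_derivative_grad_int:
  assumes "continuous_on UNIV k"
    and "\<And>z. (f has_derivative blinfun_apply (f' z)) (at z)" "continuous_on UNIV f'"
  shows "(grad_int k a f has_derivative blinfun_apply (polar_int k f' z)) (at z)"
  unfolding grad_int_def[abs_def]
  by (auto intro!: derivative_eq_intros has_derivative_polar_int assms)

context
  fixes f :: "real \<times> real \<Rightarrow> 'b::banach"
    and f' :: "real \<times> real \<Rightarrow> (real \<times> real) \<Rightarrow>\<^sub>L 'b"
  assumes f: "\<And>z. (f has_derivative blinfun_apply (f' z)) (at z)"
    and f': "continuous_on UNIV f'"
begin

text \<open>The first entry is a case of the Poincare lemma, with closedness supplied by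
  \<open>polar_int_curl\<close>; the constants \<open>a\<close> and \<open>b\<close> drop out of the
  derivatives of the other two entries.\<close>

lemma has_derivative_jet: "(jet a b f has_derivative blinfun_apply (jet_deriv a b f f' z)) (at z)"
proof -
  note d = has_derivative_grad_int[OF continuous_cos_sin(1) f f'] has_derivative_grad_int[OF continuous_cos_sin(2) f f']
  have "(line_int (grad_int cos a f) (grad_int sin b f) has_derivative
      blinfun_apply (pd_blinfun (grad_int cos a f z) (grad_int sin b f z))) (at z)"
    by (rule has_derivative_line_int[OF d])
      (auto intro!: continuous_on_polar_int continuous_cos_sin f' polar_int_curl[OF f])
  from has_derivative_Pair[OF this has_derivative_Pair[OF d]]
  show ?thesis
    unfolding jet_def[abs_def] by (rule has_derivative_eq_rhs) (simp add: fun_eq_iff jet_deriv_def)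
qed

lemma continuous_on_C1: "continuous_on S f"
  by (intro continuous_at_imp_continuous_on ballI has_derivative_continuous[OF f])

lemma continuous_on_jet_deriv: "continuous_on S (jet_deriv a b f f')"
  unfolding jet_deriv_def[abs_def]
  by (rule continuous_on_subset[OF _ subset_UNIV])
    (intro continuous_intros continuous_on_grad_int continuous_on_polar_int continuous_cos_sin f' continuous_on_C1)

text \<open>Each gradient entry is at most \<open>9 * B\<close>: 1 for the constant and 4 for each
  of two potentials. On the disk of radius 2 the line integral is at most
  \<open>2 * 2 * 9 * B\<close>, and the total 54 is rounded up to 60. The derivative, with
  \<open>9 + 9 + 4 + 4\<close>, shares the constant.\<close>

lemma norm_jet_le:
  assumes B: "norm a \<le> B" "norm b \<le> B" "\<And>z. norm (f z) \<le> B" "\<And>z. norm (f' z) \<le> B" and z: "norm z \<le> 2"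
  shows "norm (jet a b f z) \<le> 60 * B" "norm (jet_deriv a b f f' z) \<le> 60 * B"
proof -
  have B0: "0 \<le> B" using B(1) norm_ge_zero[of a] by linarith
  have P: "norm (grad_int cos a f z) \<le> 9 * B" and Q: "norm (grad_int sin b f z) \<le> 9 * B" for z
    by (auto intro!: norm_grad_int_le continuous_cos_sin continuous_on_C1 B)
  have "norm (line_int (grad_int cos a f) (grad_int sin b f) z) \<le> 2 * norm z * (9 * B)"
    by (intro norm_line_int_le continuous_on_grad_int continuous_cos_sin continuous_on_C1 P Q)
  also have "\<dots> \<le> 2 * 2 * (9 * B)"
    using z B0 by (intro mult_mono) auto
  finally show "norm (jet a b f z) \<le> 60 * B"
    unfolding jet_def
    using P[of z] Q[of z] B0 norm_triple_le[of "line_int (grad_int cos a f) (grad_int sin b f) z" "grad_int cos a f z" "grad_int sin b f z"]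
    by linarith
  have "norm (polar_int cos f' z) \<le> 4 * B" "norm (polar_int sin f' z) \<le> 4 * B"
    by (auto intro!: norm_polar_int_le continuous_cos_sin f' B)
  then show "norm (jet_deriv a b f f' z) \<le> 60 * B"
    unfolding jet_deriv_def
    using P[of z] Q[of z] B0 norm_pd_blinfun_le[of "grad_int cos a f z" "grad_int sin b f z"]
      norm_triple_blinfun_le[of "pd_blinfun (grad_int cos a f z) (grad_int sin b f z)" "polar_int cos f' z" "polar_int sin f' z"]
    by linarith
qed

end

lemma pd_blinfun_diff: "pd_blinfun a b - pd_blinfun c d = pd_blinfun (a - c) (b - d)"
  by (rule blinfun_eqI) (simp add: blinfun.bilinear_simps algebra_simps)

lemma triple_blinfun_diff:
  "triple_blinfun A B C - triple_blinfun A' B' C' = triple_blinfun (A - A') (B - B') (C - C')"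
  by (rule blinfun_eqI) (simp add: blinfun.bilinear_simps)

text \<open>The jet is affine in \<open>f\<close>, and the difference of two jets has zero data at
  the origin. Hence \<open>norm_jet_le\<close> also yields the Lipschitz estimates for the
  contraction.\<close>

lemma jet_diff:
  assumes cf: "continuous_on UNIV f" and cg: "continuous_on UNIV g"
    and cf': "continuous_on UNIV f'" and cg': "continuous_on UNIV g'"
  shows "jet a b f z - jet a b g z = jet 0 0 (\<lambda>z. f z - g z) z"
    "jet_deriv a b f f' z - jet_deriv a b g g' z = jet_deriv 0 0 (\<lambda>z. f z - g z) (\<lambda>z. f' z - g' z) z"
proof -
  have g: "grad_int k 0 (\<lambda>z. f z - g z) = (\<lambda>z. grad_int k c f z - grad_int k c g z)"
    if "continuous_on UNIV k" for k c
    by (simp add: grad_int_def fun_eq_iff polar_int_diff[OF that cf cg])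
  note gs = g[OF continuous_cos_sin(1), of a] g[OF continuous_cos_sin(2), of b]
  show "jet a b f z - jet a b g z = jet 0 0 (\<lambda>z. f z - g z) z"
    unfolding jet_def gs
    by (simp add: line_int_diff continuous_on_grad_int continuous_cos_sin cf cg)
  show "jet_deriv a b f f' z - jet_deriv a b g g' z = jet_deriv 0 0 (\<lambda>z. f z - g z) (\<lambda>z. f' z - g' z) z"
    unfolding jet_deriv_def gs
    by (simp add: triple_blinfun_diff pd_blinfun_diff polar_int_diff continuous_cos_sin cf' cg')
qed

section \<open>Local solutions of \<open>\<Delta>u = -H (u, u\<^sub>x, u\<^sub>y)\<close>\<close>

text \<open>A C^1 function is encoded as the bounded continuous pair of the function and its
  derivative. The supremum distance of \<open>bcontfun\<close> is then a C^1 distance, and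
  completeness reduces to closedness.\<close>

definition C1_ball :: "real \<Rightarrow> real \<Rightarrow> ('a::real_normed_vector \<Rightarrow>\<^sub>C ('b::banach \<times> ('a \<Rightarrow>\<^sub>L 'b))) set"
  where "C1_ball R \<rho> = {F. (\<forall>z. ((\<lambda>z. fst (apply_bcontfun F z)) has_derivative blinfun_apply (snd (apply_bcontfun F z))) (at z)) \<and>
      (\<forall>z. R \<le> norm z \<longrightarrow> apply_bcontfun F z = 0) \<and> (\<forall>z. norm (apply_bcontfun F z) \<le> \<rho>)}"

lemma C1_ballD:
  assumes "F \<in> C1_ball R \<rho>"
  shows "((\<lambda>z. fst (apply_bcontfun F z)) has_derivative blinfun_apply (snd (apply_bcontfun F z))) (at z)"
    and "R \<le> norm z \<Longrightarrow> apply_bcontfun F z = 0" and "norm (apply_bcontfun F z) \<le> \<rho>"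
  using assms by (simp_all add: C1_ball_def)

lemma C1_ballI:
  assumes "\<And>z. ((\<lambda>z. fst (apply_bcontfun F z)) has_derivative blinfun_apply (snd (apply_bcontfun F z))) (at z)"
    and "\<And>z. R \<le> norm z \<Longrightarrow> apply_bcontfun F z = 0" and "\<And>z. norm (apply_bcontfun F z) \<le> \<rho>"
  shows "F \<in> C1_ball R \<rho>"
  using assms by (simp add: C1_ball_def)

text \<open>Uniform convergence of the derivatives makes their limit the derivative of the limit;
  the support and norm conditions survive pointwise limits.\<close>

lemma complete_C1_ball: "complete (C1_ball R \<rho>)"
  unfolding complete_eq_closed closed_sequential_limits
proof (intro allI impI, elim conjE)
  fix F :: "nat \<Rightarrow> 'a \<Rightarrow>\<^sub>C ('b \<times> ('a \<Rightarrow>\<^sub>L 'b))" and l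
  assume F: "\<forall>n. F n \<in> C1_ball R \<rho>" and lim: "F \<longlonglongrightarrow> l"
  have ul: "uniform_limit UNIV F l sequentially"
    by (rule tendsto_bcontfun_uniform_limit[OF lim])
  then have pt: "(\<lambda>n. F n z) \<longlonglongrightarrow> l z" for z
    by (rule tendsto_uniform_limitI) simp
  have "\<exists>g. \<forall>x\<in>UNIV. (\<lambda>n. fst (F n x)) \<longlonglongrightarrow> g x \<and> (g has_derivative blinfun_apply (snd (l x))) (at x within UNIV)"
  proof (rule has_derivative_sequence[where f = "\<lambda>n x. fst (F n x)" and f' = "\<lambda>n x. blinfun_apply (snd (F n x))"])
    fix e :: real assume "e > 0"
    from uniform_limitD[OF ul this]
    show "\<forall>\<^sub>F n in sequentially. \<forall>x\<in>UNIV. \<forall>h. norm (blinfun_apply (snd (F n x)) h - blinfun_apply (snd (l x)) h) \<le> e * norm h"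
    proof eventually_elim
      case (elim n)
      show ?case
      proof (intro ballI allI)
        fix x :: 'a and h
        have "norm (snd (F n x) - snd (l x)) \<le> e"
          using dist_snd_le[of "F n x" "l x"] elim[rule_format, of x] by (simp add: dist_norm)
        from mult_right_mono[OF this norm_ge_zero[of h]] norm_blinfun[of "snd (F n x) - snd (l x)" h]
        show "norm (blinfun_apply (snd (F n x)) h - blinfun_apply (snd (l x)) h) \<le> e * norm h"
          unfolding blinfun.diff_left by (rule order_trans[rotated])
      qed
    qed
  next
    show "(\<lambda>n. fst (F n 0)) \<longlonglongrightarrow> fst (l 0)" by (intro tendsto_intros pt)
  qed (use F in \<open>auto simp: C1_ball_def\<close>)
  then obtain g where g: "\<And>x. (\<lambda>n. fst (F n x)) \<longlonglongrightarrow> g x"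
    "\<And>x. (g has_derivative blinfun_apply (snd (l x))) (at x)" by auto
  have "g = (\<lambda>x. fst (l x))"
    using LIMSEQ_unique[OF g(1) tendsto_fst[OF pt]] by auto
  moreover have "l z = 0" if "R \<le> norm z" for z
    using LIMSEQ_unique[OF pt[of z], of 0] F that by (simp add: C1_ball_def)
  moreover have "norm (l z) \<le> \<rho>" for z
    by (rule Lim_bounded[OF tendsto_norm[OF pt[of z]]]) (use F in \<open>auto simp: C1_ball_def\<close>)
  ultimately show "l \<in> C1_ball R \<rho>" using g(2) by (simp add: C1_ball_def)
qed

text \<open>A quantitative form of vanishing to second order at \<open>s0\<close>: the Lipschitz
  bound on \<open>H'\<close> gives size of order \<open>N\<close> for \<open>H'\<close>, and the
  mean value inequality passes this on to \<open>H\<close>. The extra factor \<open>N\<close> is the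
  source of contraction on small balls.\<close>

lemma C1_lipschitz_bounds:
  fixes H :: "'a::real_normed_vector \<Rightarrow> 'b::banach"
  assumes H: "\<And>s. s \<in> cball s0 r \<Longrightarrow> (H has_derivative blinfun_apply (H' s)) (at s)"
    and L: "L-lipschitz_on (cball s0 r) H'"
    and 0: "H s0 = 0" "H' s0 = 0" and N: "0 \<le> N" "N \<le> r"
  shows "s \<in> cball s0 N \<Longrightarrow> norm (H' s) \<le> L * N"
    and "s \<in> cball s0 N \<Longrightarrow> t \<in> cball s0 N \<Longrightarrow> norm (H s - H t) \<le> L * N * norm (s - t)"
    and "s \<in> cball s0 N \<Longrightarrow> norm (H s) \<le> L * N * N"
proof -
  have L0: "0 \<le> L" by (rule lipschitz_on_nonneg[OF L])
  show 1: "norm (H' s) \<le> L * N" if "s \<in> cball s0 N" for s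
  proof -
    have "norm (H' s) \<le> L * dist s s0"
      using lipschitz_onD[OF L, of s s0] that N 0 by (simp add: dist_norm norm_minus_commute)
    also have "\<dots> \<le> L * N" using that L0 by (intro mult_left_mono) (auto simp: dist_commute)
    finally show ?thesis .
  qed
  show 2: "norm (H s - H t) \<le> L * N * norm (s - t)" if "s \<in> cball s0 N" "t \<in> cball s0 N" for s t
  proof (rule differentiable_bound[OF convex_cball _ _ that])
    fix x assume x: "x \<in> cball s0 N"
    then show "(H has_derivative blinfun_apply (H' x)) (at x within cball s0 N)"
      using H[of x] N by (auto intro: has_derivative_at_withinI)
    show "onorm (blinfun_apply (H' x)) \<le> L * N"
      using 1[OF x] by (simp add: norm_blinfun.rep_eq)
  qed
  show "norm (H s) \<le> L * N * N" if s: "s \<in> cball s0 N"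
  proof -
    have "norm (H s - H s0) \<le> L * N * norm (s - s0)" using s N by (intro 2) auto
    also have "\<dots> \<le> L * N * N"
      using s L0 N by (intro mult_left_mono) (auto simp: dist_norm norm_minus_commute)
    finally show ?thesis using 0 by simp
  qed
qed

lemma local_solution:
  fixes H :: "'b \<times> 'b \<times> 'b \<Rightarrow> 'b::banach"
  assumes r: "0 < r"
    and H: "\<And>s. s \<in> cball (p, 0, 0) r \<Longrightarrow> (H has_derivative blinfun_apply (H' s)) (at s)"
    and L: "L-lipschitz_on (cball (p, 0, 0) r) H'"
    and H0: "H (p, 0, 0) = 0" "H' (p, 0, 0) = 0"
  obtains \<delta> where "0 < \<delta>"
    "\<And>a b. norm a \<le> \<delta> \<Longrightarrow> norm b \<le> \<delta> \<Longrightarrow> \<exists>u P Q P' Q'.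
       (\<forall>z. (u has_derivative blinfun_apply (pd_blinfun (P z) (Q z))) (at z)) \<and>
       (\<forall>z. (P has_derivative blinfun_apply (P' z)) (at z)) \<and> continuous_on UNIV P' \<and>
       (\<forall>z. (Q has_derivative blinfun_apply (Q' z)) (at z)) \<and> continuous_on UNIV Q' \<and>
       u 0 = p \<and> P 0 = a \<and> Q 0 = b \<and>
       (\<forall>z\<in>ball 0 1. (u z, P z, Q z) \<in> cball (p, 0, 0) r \<and>
          blinfun_apply (P' z) (1, 0) + blinfun_apply (Q' z) (0, 1) = - H (u z, P z, Q z))"
proof -
  obtain \<psi> :: "real \<times> real \<Rightarrow> real" and \<psi>' K where \<psi>: "\<And>z. (\<psi> has_derivative blinfun_apply (\<psi>' z)) (at z)" "continuous_on UNIV \<psi>'"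
    "\<And>z. \<bar>\<psi> z\<bar> \<le> 1" "\<And>z. norm z \<le> 1 \<Longrightarrow> \<psi> z = 1"
    "\<And>z. 3/2 \<le> norm z \<Longrightarrow> \<psi> z = 0" "\<And>z. 3/2 \<le> norm z \<Longrightarrow> \<psi>' z = 0"
    "\<And>z. norm (\<psi>' z) \<le> K"
    using ex_cutoff by blast
  have K0: "0 \<le> K" using \<psi>(7)[of 0] norm_ge_zero[of "\<psi>' 0"] by linarith
  have L0: "0 \<le> L" by (rule lipschitz_on_nonneg[OF L])
  \<comment> \<open>The first bound keeps jets, of size up to \<open>60 * \<rho>\<close>, inside the
    ball of radius \<open>r\<close> where \<open>H\<close> is controlled. In the second, 7200 is
    \<open>60 * 60 * 2\<close>: one 60 from \<open>N\<close>, one from the jet estimates, and 2 for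
    the contraction constant. \<open>L + 1\<close> guards against \<open>L = 0\<close>.\<close>
  define \<rho> where "\<rho> = min (r / 60) (1 / (7200 * (K + 3) * (L + 1)))"
  have \<rho>: "0 < \<rho>" using r K0 L0 by (simp add: \<rho>_def)
  define N where "N = 60 * \<rho>"
  have N: "0 \<le> N" "N \<le> r" using \<rho> by (auto simp: N_def \<rho>_def)
  have small: "60 * (K + 3) * (L * N) \<le> 1 / 2"
  proof -
    have "60 * (K + 3) * (L * N) \<le> 60 * (K + 3) * ((L + 1) * (60 * (1 / (7200 * (K + 3) * (L + 1)))))"
      using K0 L0 \<rho> unfolding N_def by (intro mult_mono) (auto simp: \<rho>_def)
    also have "\<dots> = 1 / 2" using K0 L0 by (simp add: field_simps add_nonneg_eq_0_iff)
    finally show ?thesis .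
  qed
  let ?s0 = "(p, 0, 0) :: 'b \<times> 'b \<times> 'b"
  have Hb: "\<And>s. s \<in> cball ?s0 N \<Longrightarrow> norm (H' s) \<le> L * N"
    "\<And>s t. s \<in> cball ?s0 N \<Longrightarrow> t \<in> cball ?s0 N \<Longrightarrow> norm (H s - H t) \<le> L * N * norm (s - t)"
    "\<And>s. s \<in> cball ?s0 N \<Longrightarrow> norm (H s) \<le> L * N * N"
    by (rule C1_lipschitz_bounds[OF H L H0 N], assumption+)+
  have cH: "continuous_on (cball ?s0 r) H"
    by (intro continuous_at_imp_continuous_on ballI has_derivative_continuous[OF H])
  have cH': "continuous_on (cball ?s0 r) H'" by (rule lipschitz_on_continuous_on[OF L])
  show ?thesis
  proof (rule that[OF \<rho>])
    fix a b :: 'b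
    assume ab: "norm a \<le> \<rho>" "norm b \<le> \<rho>"
    define S where "S = (C1_ball 2 \<rho> :: ((real \<times> real) \<Rightarrow>\<^sub>C ('b \<times> ((real \<times> real) \<Rightarrow>\<^sub>L 'b))) set)"
    define f where "f F z = fst (apply_bcontfun F z)" for F :: "(real \<times> real) \<Rightarrow>\<^sub>C ('b \<times> ((real \<times> real) \<Rightarrow>\<^sub>L 'b))" and z
    define f' where "f' F z = snd (apply_bcontfun F z)" for F :: "(real \<times> real) \<Rightarrow>\<^sub>C ('b \<times> ((real \<times> real) \<Rightarrow>\<^sub>L 'b))" and z
    define W where "W F z = ?s0 + jet a b (f F) z" for F z
    define W' where "W' F z = jet_deriv a b (f F) (f' F) z" for F z
    define \<Phi> where "\<Phi> F z = (if norm z < 2 then (- (\<psi> z *\<^sub>R H (W F z)),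
        - ((blinfun_scaleR_left (H (W F z)) o\<^sub>L \<psi>' z) + \<psi> z *\<^sub>R (H' (W F z) o\<^sub>L W' F z))) else 0)" for F z
    have cf: "continuous_on UNIV (f F)" "continuous_on UNIV (f' F)" for F
      unfolding f_def[abs_def] f'_def[abs_def] by (intro continuous_intros continuous_on_apply_bcontfun)+
    have df: "(f F has_derivative blinfun_apply (f' F z)) (at z)" if "F \<in> S" for F z
      using C1_ballD(1)[of F 2 \<rho> z] that unfolding S_def f_def[abs_def] f'_def .
    have fb: "norm (f F z) \<le> \<rho>" "norm (f' F z) \<le> \<rho>" if "F \<in> S" for F z
      using C1_ballD(3)[of F 2 \<rho> z] that norm_fst_le[of "f F z" "f' F z"] norm_snd_le[of "f' F z" "f F z"]
      unfolding S_def f_def f'_def prod.collapse by linarith+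
    have dW: "(W F has_derivative blinfun_apply (W' F z)) (at z)" if "F \<in> S" for F z
      unfolding W_def[abs_def] W'_def
      using has_derivative_add[OF has_derivative_const[of ?s0] has_derivative_jet[OF df[OF that] cf(2)]] by simp
    have cW': "continuous_on A (W' F)" if "F \<in> S" for F A
      unfolding W'_def[abs_def] by (intro continuous_on_jet_deriv df that cf)
    have cW: "continuous_on A (W F)" if "F \<in> S" for F A
      by (intro continuous_at_imp_continuous_on ballI has_derivative_continuous[OF dW] that)
    have jb: "norm (jet a b (f F) z) \<le> N" "norm (W' F z) \<le> N" if "F \<in> S" "norm z \<le> 2" for F z
      using norm_jet_le[OF df[OF that(1)] cf(2) ab fb[OF that(1)] that(2)] unfolding N_def W'_def by auto
    have WN: "W F z \<in> cball ?s0 N" if "F \<in> S" "norm z \<le> 2" for F z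
      using jb(1)[OF that] by (simp add: W_def dist_norm)
    have Wr: "W F z \<in> cball ?s0 r" if "F \<in> S" "norm z \<le> 2" for F z
      using WN[OF that] N by auto
    have diffs: "norm (W F z - W G z) \<le> 60 * dist F G" "norm (W' F z - W' G z) \<le> 60 * dist F G"
      if "F \<in> S" "G \<in> S" "norm z \<le> 2" for F G z
    proof -
      have *: "norm (f F z - f G z) \<le> dist F G" "norm (f' F z - f' G z) \<le> dist F G" for z
        using dist_fst_le[of "apply_bcontfun F z" "apply_bcontfun G z"] dist_snd_le[of "apply_bcontfun F z" "apply_bcontfun G z"]
          dist_bounded[of F z G] by (auto simp: f_def f'_def dist_norm)
      note ** = norm_jet_le[of "\<lambda>z. f F z - f G z" "\<lambda>z. f' F z - f' G z" 0 "dist F G" 0 z]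
      have d: "((\<lambda>z. f F z - f G z) has_derivative blinfun_apply (f' F z - f' G z)) (at z)" for z
        using has_derivative_diff[OF df df] that by (simp add: blinfun.diff_left[abs_def])
      have c: "continuous_on UNIV (\<lambda>z. f' F z - f' G z)" by (intro continuous_intros cf)
      show "norm (W F z - W G z) \<le> 60 * dist F G" "norm (W' F z - W' G z) \<le> 60 * dist F G"
        using **[OF d c] * that by (simp_all add: W_def W'_def jet_diff[OF cf(1) cf(1) cf(2) cf(2)])
    qed
    have far: "\<Phi> F z = 0" if "3/2 \<le> norm z" for F z
      using \<psi>(5,6)[OF that] by (simp add: \<Phi>_def zero_prod_def)
    \<comment> \<open>Continuity and differentiability are local, so they are checked on the open
      disk, where the formula holds, and on the open outer region, where the map is 0.\<close>
    have cover: "UNIV = ball 0 2 \<union> {z::real \<times> real. 3/2 < norm z}" by auto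
    have op: "open {z::real \<times> real. 3/2 < norm z}" by (intro open_Collect_less continuous_intros)
    have c\<psi>: "continuous_on A \<psi>" for A
      by (intro continuous_at_imp_continuous_on ballI has_derivative_continuous[OF \<psi>(1)])
    have c\<Phi>: "continuous_on UNIV (\<Phi> F)" if F: "F \<in> S" for F
      unfolding cover
    proof (intro continuous_on_open_Un open_ball op)
      have cHW: "continuous_on (ball 0 2) (\<lambda>z. H (W F z))" "continuous_on (ball 0 2) (\<lambda>z. H' (W F z))"
        using Wr[OF F] by (auto intro!: continuous_on_compose2[OF cH] continuous_on_compose2[OF cH'] cW F)
      have "continuous_on (ball 0 2) (\<lambda>z. (- (\<psi> z *\<^sub>R H (W F z)),
        - ((blinfun_scaleR_left (H (W F z)) o\<^sub>L \<psi>' z) + \<psi> z *\<^sub>R (H' (W F z) o\<^sub>L W' F z))))"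
        by (intro continuous_intros cHW c\<psi> cW' F continuous_on_subset[OF \<psi>(2) subset_UNIV]
           bounded_linear.continuous_on[OF bounded_linear_blinfun_scaleR_left])
      then show "continuous_on (ball 0 2) (\<Phi> F)"
        by (rule continuous_on_eq) (simp add: \<Phi>_def)
      show "continuous_on {z. 3 / 2 < norm z} (\<Phi> F)"
        by (rule continuous_on_eq[OF continuous_on_const[of _ 0]]) (simp add: far)
    qed
    have d\<Phi>: "((\<lambda>z. fst (\<Phi> F z)) has_derivative blinfun_apply (snd (\<Phi> F z))) (at z)" if F: "F \<in> S" for F z
    proof (cases "norm z < 2")
      case True
      then have "((\<lambda>z. H (W F z)) has_derivative (\<lambda>h. blinfun_apply (H' (W F z)) (blinfun_apply (W' F z) h))) (at z)"
        by (intro has_derivative_compose[OF dW[OF F]] H Wr F) auto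
      then have "((\<lambda>z. - (\<psi> z *\<^sub>R H (W F z))) has_derivative
          (\<lambda>h. - (\<psi> z *\<^sub>R blinfun_apply (H' (W F z)) (blinfun_apply (W' F z) h) + blinfun_apply (\<psi>' z) h *\<^sub>R H (W F z)))) (at z)"
        by (intro has_derivative_minus has_derivative_scaleR \<psi>)
      moreover have "(\<lambda>h. - (\<psi> z *\<^sub>R blinfun_apply (H' (W F z)) (blinfun_apply (W' F z) h) + blinfun_apply (\<psi>' z) h *\<^sub>R H (W F z)))
         = blinfun_apply (snd (\<Phi> F z))"
        using True by (simp add: \<Phi>_def fun_eq_iff blinfun.bilinear_simps)
      ultimately have "((\<lambda>z. - (\<psi> z *\<^sub>R H (W F z))) has_derivative blinfun_apply (snd (\<Phi> F z))) (at z)" by simp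
      then show ?thesis
        by (rule has_derivative_transform_within_open[OF _ open_ball[of 0 2]]) (use True in \<open>auto simp: \<Phi>_def\<close>)
    next
      case False
      then have "((\<lambda>_. 0) has_derivative blinfun_apply (snd (\<Phi> F z))) (at z)"
        using far[of z F] by (simp add: zero_blinfun.rep_eq[abs_def])
      then show ?thesis
        by (rule has_derivative_transform_within_open[OF _ op]) (use False far in auto)
    qed
    have LN: "0 \<le> L * N" using L0 N by simp
    have b\<Phi>: "norm (\<Phi> F z) \<le> \<rho>" if F: "F \<in> S" for F z
    proof (cases "norm z < 2")
      case True
      then have z: "norm z \<le> 2" by simp
      have h: "norm (H (W F z)) \<le> L * N * N" "norm (H' (W F z)) \<le> L * N"
        using Hb WN[OF F z] by auto
      have "norm (\<psi> z *\<^sub>R H (W F z)) \<le> 1 * (L * N * N)"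
        using h \<psi>(3) by (simp only: norm_scaleR) (intro mult_mono, auto)
      moreover have "norm (blinfun_scaleR_left (H (W F z)) o\<^sub>L \<psi>' z) \<le> (L * N * N) * K"
      proof (rule order_trans[OF norm_blinfun_compose mult_mono])
        show "norm (blinfun_scaleR_left (H (W F z))) \<le> L * N * N"
          using h by (intro norm_blinfun_bound order_trans[OF norm_ge_zero h(1)]) (auto intro!: mult_right_mono simp: mult.commute[of "\<bar>_\<bar>"])
      qed (use \<psi>(7) LN N in auto)
      moreover have "norm (\<psi> z *\<^sub>R (H' (W F z) o\<^sub>L W' F z)) \<le> 1 * (L * N * N)"
        unfolding norm_scaleR
        by (intro mult_mono order_trans[OF norm_blinfun_compose] jb[OF F z] h) (use \<psi>(3) LN N in auto)
      moreover have "norm (\<Phi> F z) \<le> norm (\<psi> z *\<^sub>R H (W F z)) +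
          (norm (blinfun_scaleR_left (H (W F z)) o\<^sub>L \<psi>' z) + norm (\<psi> z *\<^sub>R (H' (W F z) o\<^sub>L W' F z)))"
        using True norm_Pair_le[of "- (\<psi> z *\<^sub>R H (W F z))" "- ((blinfun_scaleR_left (H (W F z)) o\<^sub>L \<psi>' z) + \<psi> z *\<^sub>R (H' (W F z) o\<^sub>L W' F z))"]
          norm_triangle_ineq[of "blinfun_scaleR_left (H (W F z)) o\<^sub>L \<psi>' z" "\<psi> z *\<^sub>R (H' (W F z) o\<^sub>L W' F z)"]
        unfolding \<Phi>_def by (simp only: if_True norm_minus_cancel)
      ultimately have "norm (\<Phi> F z) \<le> L * N * N * (K + 2)" by (simp add: algebra_simps)
      \<comment> \<open>One of the two factors \<open>N\<close> is turned into
        \<open>60 * \<rho>\<close>; the remaining one is small enough to return the image to the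
        ball of radius \<rho>.\<close>
      also have "\<dots> = (60 * (K + 2) * (L * N)) * \<rho>" by (simp add: N_def)
      also have "\<dots> \<le> 1 * \<rho>"
      proof (rule mult_right_mono)
        have "60 * (K + 2) * (L * N) \<le> 60 * (K + 3) * (L * N)" using LN by (intro mult_right_mono) auto
        then show "60 * (K + 2) * (L * N) \<le> 1" using small by linarith
      qed (use \<rho> in simp)
      finally show ?thesis by simp
    next
      case False
      then show ?thesis using \<rho> by (simp add: \<Phi>_def)
    qed
    have l\<Phi>: "norm (\<Phi> F z - \<Phi> G z) \<le> 1/2 * dist F G" if F: "F \<in> S" and G: "G \<in> S" for F G z
    proof (cases "norm z < 2")
      case True
      then have z: "norm z \<le> 2" by simp
      let ?D = "dist F G"
      have h: "norm (H (W F z) - H (W G z)) \<le> L * N * (60 * ?D)"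
        by (rule order_trans[OF Hb(2)[OF WN[OF F z] WN[OF G z]] mult_left_mono[OF diffs(1)[OF F G z] LN]])
      have h': "norm (H' (W F z) - H' (W G z)) \<le> L * (60 * ?D)"
        using order_trans[OF lipschitz_onD[OF L Wr[OF F z] Wr[OF G z]], of "L * (60 * ?D)"]
          mult_left_mono[OF diffs(1)[OF F G z] L0] by (simp add: dist_norm)
      \<comment> \<open>\<open>?A\<close> is the change of the function, \<open>?B\<close> comes
        from the derivative of the cutoff, and \<open>?C\<close> and \<open>?E\<close> split the
        change of the product of \<open>H'\<close> and \<open>W'\<close> in the usual way. Bounded
        by 1, \<open>K\<close>, 1 and 1 times \<open>60 * (L * N) * ?D\<close>, they add up to the
        factor \<open>K + 3\<close>.\<close>
      let ?A = "\<psi> z *\<^sub>R (H (W F z) - H (W G z))"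
      let ?B = "blinfun_scaleR_left (H (W F z) - H (W G z)) o\<^sub>L \<psi>' z"
      let ?C = "\<psi> z *\<^sub>R ((H' (W F z) - H' (W G z)) o\<^sub>L W' F z)"
      let ?E = "\<psi> z *\<^sub>R (H' (W G z) o\<^sub>L (W' F z - W' G z))"
      have "norm ?A \<le> 1 * (L * N * (60 * ?D))"
        using h \<psi>(3) by (simp only: norm_scaleR) (intro mult_mono, auto)
      moreover have "norm ?B \<le> (L * N * (60 * ?D)) * K"
      proof (rule order_trans[OF norm_blinfun_compose mult_mono])
        show "norm (blinfun_scaleR_left (H (W F z) - H (W G z))) \<le> L * N * (60 * ?D)"
          using h by (intro norm_blinfun_bound order_trans[OF norm_ge_zero h]) (auto intro!: mult_right_mono simp: mult.commute[of "\<bar>_\<bar>"])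
      qed (use \<psi>(7) LN N in auto)
      moreover have "norm ?C \<le> 1 * (L * (60 * ?D) * N)"
        unfolding norm_scaleR
        by (intro mult_mono order_trans[OF norm_blinfun_compose] jb[OF F z] h') (use \<psi>(3) L0 N in auto)
      moreover have "norm ?E \<le> 1 * (L * N * (60 * ?D))"
        unfolding norm_scaleR
        by (intro mult_mono order_trans[OF norm_blinfun_compose] Hb(1) WN[OF G z] diffs[OF F G z]) (use \<psi>(3) LN N in auto)
      moreover have "\<Phi> F z - \<Phi> G z = (- ?A, - (?B + ?C + ?E))"
        using True by (auto simp: \<Phi>_def scaleR_diff_right intro!: blinfun_eqI) (simp add: blinfun.bilinear_simps algebra_simps)
      moreover have "norm (- ?A, - (?B + ?C + ?E)) \<le> norm ?A + (norm ?B + norm ?C + norm ?E)"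
        using norm_Pair_le[of "- ?A" "- (?B + ?C + ?E)"] norm_triangle_ineq[of "?B + ?C" ?E] norm_triangle_ineq[of ?B ?C]
        unfolding norm_minus_cancel by linarith
      ultimately have "norm (\<Phi> F z - \<Phi> G z) \<le> (60 * (K + 3) * (L * N)) * ?D" by (simp add: algebra_simps)
      also have "\<dots> \<le> 1/2 * ?D" using small by (intro mult_right_mono) auto
      finally show ?thesis .
    next
      case False
      then show ?thesis by (simp add: \<Phi>_def)
    qed
    have bc: "\<Phi> F \<in> bcontfun" if "F \<in> S" for F
      by (rule bcontfun_normI[OF c\<Phi> b\<Phi>]) (fact that)+
    define \<Theta> where "\<Theta> F = Bcontfun (\<Phi> F)" for F
    have \<Theta>: "apply_bcontfun (\<Theta> F) = \<Phi> F" if "F \<in> S" for F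
      unfolding \<Theta>_def using bc[OF that] by (rule Bcontfun_inverse)
    have "\<exists>!F\<in>S. \<Theta> F = F"
    proof (rule Banach_fix[where c = "1/2"])
      show "complete S" unfolding S_def by (rule complete_C1_ball)
      have "0 \<in> S" unfolding S_def using \<rho> by (intro C1_ballI) (auto simp: zero_blinfun.rep_eq[abs_def])
      then show "S \<noteq> {}" by auto
      show "\<Theta> ` S \<subseteq> S"
      proof safe
        fix F assume F: "F \<in> S"
        then show "\<Theta> F \<in> S"
          unfolding S_def
          by (intro C1_ballI, unfold \<Theta>[OF F]) (use d\<Phi>[OF F] b\<Phi>[OF F] far[of _ F] in auto)
      qed
      show "dist (\<Theta> F) (\<Theta> G) \<le> 1/2 * dist F G" if "F \<in> S" "G \<in> S" for F G
        by (rule dist_bound) (simp only: \<Theta>[OF that(1)] \<Theta>[OF that(2)] dist_norm[of "\<Phi> F _"] l\<Phi>[OF that])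
    qed auto
    then obtain F where F: "F \<in> S" "\<Theta> F = F" by auto
    \<comment> \<open>On the unit disk the cutoff is 1, so there the fixed point solves the equation
      without it.\<close>
    have feq: "f F z = - H (W F z)" if "norm z < 1" for z
      using arg_cong[OF \<Theta>[OF F(1)], of "\<lambda>g. fst (g z)"] \<psi>(4)[of z] that
      by (simp add: F(2) f_def \<Phi>_def)
    have f0: "f F z = 0" if "2 \<le> norm z" for z
      using C1_ballD(2)[of F 2 \<rho> z] F(1) that by (simp add: S_def f_def)
    let ?P = "grad_int cos a (f F)" and ?Q = "grad_int sin b (f F)"
    let ?u = "\<lambda>z. p + line_int ?P ?Q z"
    have WF: "W F z = (?u z, ?P z, ?Q z)" for z
      by (simp add: W_def jet_def)
    note d = has_derivative_grad_int[OF continuous_cos_sin(1) df[OF F(1)] cf(2)]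
      has_derivative_grad_int[OF continuous_cos_sin(2) df[OF F(1)] cf(2)]
    show "\<exists>u P Q P' Q'.
       (\<forall>z. (u has_derivative blinfun_apply (pd_blinfun (P z) (Q z))) (at z)) \<and>
       (\<forall>z. (P has_derivative blinfun_apply (P' z)) (at z)) \<and> continuous_on UNIV P' \<and>
       (\<forall>z. (Q has_derivative blinfun_apply (Q' z)) (at z)) \<and> continuous_on UNIV Q' \<and>
       u 0 = p \<and> P 0 = a \<and> Q 0 = b \<and>
       (\<forall>z\<in>ball 0 1. (u z, P z, Q z) \<in> cball (p, 0, 0) r \<and>
          blinfun_apply (P' z) (1, 0) + blinfun_apply (Q' z) (0, 1) = - H (u z, P z, Q z))"
    proof (intro exI conjI allI ballI)
      show "(?u has_derivative blinfun_apply (pd_blinfun (?P z) (?Q z))) (at z)" for z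
      proof -
        have "(line_int ?P ?Q has_derivative blinfun_apply (pd_blinfun (?P z) (?Q z))) (at z)"
          by (rule has_derivative_line_int[OF d])
            (auto intro!: continuous_on_polar_int continuous_cos_sin cf polar_int_curl[OF df[OF F(1)]])
        then show ?thesis by (auto intro!: derivative_eq_intros)
      qed
      fix z :: "real \<times> real" assume "z \<in> ball 0 1"
      then have z: "norm z < 1" by simp
      show "(?u z, ?P z, ?Q z) \<in> cball (p, 0, 0) r"
        using Wr[OF F(1), of z] z unfolding WF by simp
      show "blinfun_apply (polar_int cos (f' F) z) (1, 0) + blinfun_apply (polar_int sin (f' F) z) (0, 1)
          = - H (?u z, ?P z, ?Q z)"
        using polar_int_divergence[OF df[OF F(1)] cf(2), of z] z f0 feq[of z] unfolding WF by simp
    qed (auto simp: grad_int_def intro!: d[unfolded grad_int_def] continuous_on_polar_int continuous_cos_sin cf)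
  qed
qed

section \<open>Functions of class \<open>C\<^sup>k\<close>\<close>

lemma partial_deriv_eq: "(f has_derivative f') (at z) \<Longrightarrow> partial_deriv e f z = f' e"
  by (simp add: partial_deriv_def frechet_derivative_at[symmetric])

lemma Ck_on_SucD:
  assumes "Ck_on (Suc k) f S" "x \<in> S"
  shows "(f has_derivative (\<lambda>h. partial_deriv h f x)) (at x)"
  using assms by (auto simp: partial_deriv_def frechet_derivative_works[symmetric])

lemma Ck_on_cong:
  assumes "open S" and "\<And>x. x \<in> S \<Longrightarrow> f x = g x" and "Ck_on k f S"
  shows "Ck_on k g S"
  using assms(2,3)
proof (induction k arbitrary: f g)
  case 0
  then show ?case by (auto intro: continuous_on_eq)
next
  case (Suc k)
  have d: "(g has_derivative (\<lambda>h. partial_deriv h f x)) (at x)" if x: "x \<in> S" for x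
    by (rule has_derivative_transform_within_open[OF Ck_on_SucD[OF Suc.prems(2) x] assms(1) x])
      (use Suc.prems in auto)
  have "Ck_on k (partial_deriv e g) S" if "e \<in> Basis" for e
    by (rule Suc.IH[of "partial_deriv e f"]) (use Suc.prems(2) that partial_deriv_eq[OF d] in auto)
  then show ?case using d by (auto simp: differentiable_def)
qed

lemma Ck_on_SucI:
  assumes "open S" and d: "\<And>x. x \<in> S \<Longrightarrow> (f has_derivative f' x) (at x)"
    and k: "\<And>e. e \<in> Basis \<Longrightarrow> Ck_on k (\<lambda>x. f' x e) S"
  shows "Ck_on (Suc k) f S"
proof -
  have "Ck_on k (partial_deriv e f) S" if "e \<in> Basis" for e
    by (rule Ck_on_cong[OF assms(1) _ k[OF that]]) (simp add: partial_deriv_eq[OF d])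
  then show ?thesis using d by (auto simp: differentiable_def)
qed

lemma Ck_on_Suc_imp: "Ck_on (Suc k) f S \<Longrightarrow> Ck_on k f S"
proof (induction k arbitrary: f)
  case 0
  then show ?case
    by (auto intro!: continuous_at_imp_continuous_on differentiable_imp_continuous_within)
qed simp

lemma Ck_on_subset: "Ck_on k f S \<Longrightarrow> T \<subseteq> S \<Longrightarrow> Ck_on k f T"
  by (induction k arbitrary: f) (auto intro: continuous_on_subset)

lemma Ck_on_const: "open S \<Longrightarrow> Ck_on k (\<lambda>_. c) S"
proof (induction k arbitrary: c)
  case (Suc k)
  then show ?case by (intro Ck_on_SucI[where f' = "\<lambda>_ _. 0"]) auto
qed simp

lemma Ck_on_linear: "bounded_linear L \<Longrightarrow> open S \<Longrightarrow> Ck_on k L S"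
proof (cases k)
  case (Suc k)
  assume "bounded_linear L" "open S"
  then show ?thesis unfolding Suc
    by (intro Ck_on_SucI[where f' = "\<lambda>_. L"] Ck_on_const bounded_linear_imp_has_derivative)
qed (simp add: linear_continuous_on)

lemma Ck_on_linear_comp:
  assumes L: "bounded_linear L" and S: "open S"
  shows "Ck_on k f S \<Longrightarrow> Ck_on k (\<lambda>x. L (f x)) S"
proof (induction k arbitrary: f)
  case 0
  then show ?case by (simp add: bounded_linear.continuous_on[OF L])
next
  case (Suc k)
  show ?case
  proof (rule Ck_on_SucI[OF S])
    show "((\<lambda>x. L (f x)) has_derivative (\<lambda>h. L (partial_deriv h f x))) (at x)" if "x \<in> S" for x
      by (rule bounded_linear.has_derivative[OF L Ck_on_SucD[OF Suc.prems that]])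
    show "Ck_on k (\<lambda>x. L (partial_deriv e f x)) S" if "e \<in> Basis" for e
      using Suc.prems that by (intro Suc.IH) simp
  qed
qed

lemma Ck_on_add:
  assumes S: "open S"
  shows "Ck_on k f S \<Longrightarrow> Ck_on k g S \<Longrightarrow> Ck_on k (\<lambda>x. f x + g x) S"
proof (induction k arbitrary: f g)
  case 0
  then show ?case by (simp add: continuous_on_add)
next
  case (Suc k)
  show ?case
  proof (rule Ck_on_SucI[OF S])
    show "((\<lambda>x. f x + g x) has_derivative (\<lambda>h. partial_deriv h f x + partial_deriv h g x)) (at x)" if "x \<in> S" for x
      by (intro has_derivative_add Ck_on_SucD[OF Suc.prems(1) that] Ck_on_SucD[OF Suc.prems(2) that])
    show "Ck_on k (\<lambda>x. partial_deriv e f x + partial_deriv e g x) S" if "e \<in> Basis" for e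
      using Suc.prems that by (intro Suc.IH) simp_all
  qed
qed

lemma Ck_on_sum:
  assumes S: "open S" and "\<And>i. i \<in> I \<Longrightarrow> Ck_on k (f i) S"
  shows "Ck_on k (\<lambda>x. \<Sum>i\<in>I. f i x) S"
  using assms(2)
  by (induction I rule: infinite_finite_induct) (auto intro!: Ck_on_const Ck_on_add S)

lemma Ck_on_bilinear:
  assumes B: "bounded_bilinear B" and S: "open S"
  shows "Ck_on k f S \<Longrightarrow> Ck_on k g S \<Longrightarrow> Ck_on k (\<lambda>x. B (f x) (g x)) S"
proof (induction k arbitrary: f g)
  case 0
  then show ?case by (simp add: bounded_bilinear.continuous_on[OF B])
next
  case (Suc k)
  show ?case
  proof (rule Ck_on_SucI[OF S])
    show "((\<lambda>x. B (f x) (g x)) has_derivative (\<lambda>h. B (f x) (partial_deriv h g x) + B (partial_deriv h f x) (g x))) (at x)"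
      if "x \<in> S" for x
      by (intro bounded_bilinear.FDERIV[OF B] Ck_on_SucD[OF Suc.prems(1) that] Ck_on_SucD[OF Suc.prems(2) that])
    show "Ck_on k (\<lambda>x. B (f x) (partial_deriv e g x) + B (partial_deriv e f x) (g x)) S" if "e \<in> Basis" for e
      using Suc.prems that Ck_on_Suc_imp[OF Suc.prems(1)] Ck_on_Suc_imp[OF Suc.prems(2)]
      by (intro Ck_on_add S Suc.IH) simp_all
  qed
qed

lemma Ck_on_minus: "open S \<Longrightarrow> Ck_on k f S \<Longrightarrow> Ck_on k (\<lambda>x. - f x) S"
  by (rule Ck_on_linear_comp[OF bounded_linear_minus[OF bounded_linear_ident]])

lemma Ck_on_diff: "open S \<Longrightarrow> Ck_on k f S \<Longrightarrow> Ck_on k g S \<Longrightarrow> Ck_on k (\<lambda>x. f x - g x) S"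
  using Ck_on_add[of S k f "\<lambda>x. - g x"] by (simp add: Ck_on_minus)

lemma Ck_on_mult:
  fixes f g :: "'a::euclidean_space \<Rightarrow> real"
  shows "open S \<Longrightarrow> Ck_on k f S \<Longrightarrow> Ck_on k g S \<Longrightarrow> Ck_on k (\<lambda>x. f x * g x) S"
  by (rule Ck_on_bilinear[OF bounded_bilinear_mult])

lemma Ck_on_prod:
  fixes f :: "'i \<Rightarrow> 'a::euclidean_space \<Rightarrow> real"
  assumes S: "open S" and "\<And>i. i \<in> I \<Longrightarrow> Ck_on k (f i) S"
  shows "Ck_on k (\<lambda>x. \<Prod>i\<in>I. f i x) S"
  using assms(2)
  by (induction I rule: infinite_finite_induct) (auto intro!: Ck_on_const Ck_on_mult S)

text \<open>The chain rule differentiates \<open>g\<close> in the moving direction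
  \<open>partial_deriv h f x\<close>, whereas \<open>Ck_on\<close> speaks of fixed basis directions.
  Expanding that direction in the basis leaves products to which the induction hypothesis
  applies.\<close>

lemma Ck_on_compose:
  fixes f :: "'a::euclidean_space \<Rightarrow> 'b::euclidean_space" and g :: "'b \<Rightarrow> 'c::real_normed_vector"
  assumes S: "open S" and T: "f ` S \<subseteq> T"
  shows "Ck_on k f S \<Longrightarrow> Ck_on k g T \<Longrightarrow> Ck_on k (\<lambda>x. g (f x)) S"
proof (induction k arbitrary: g)
  case 0
  then show ?case using T by (auto intro: continuous_on_compose2)
next
  case (Suc k)
  have lin: "partial_deriv h g y = (\<Sum>b\<in>Basis. (h \<bullet> b) *\<^sub>R partial_deriv b g y)" if "y \<in> T" for h y
  proof -
    have l: "linear (\<lambda>h. partial_deriv h g y)"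
      using Ck_on_SucD[OF Suc.prems(2) that] by (rule has_derivative_linear)
    have "partial_deriv (\<Sum>b\<in>Basis. (h \<bullet> b) *\<^sub>R b) g y = (\<Sum>b\<in>Basis. (h \<bullet> b) *\<^sub>R partial_deriv b g y)"
      by (simp only: linear_sum[OF l] linear_scale[OF l])
    then show ?thesis by (simp add: euclidean_representation)
  qed
  show ?case
  proof (rule Ck_on_SucI[OF S])
    fix x assume x: "x \<in> S"
    then have "f x \<in> T" using T by auto
    then have "((\<lambda>x. g (f x)) has_derivative (\<lambda>h. partial_deriv (partial_deriv h f x) g (f x))) (at x)"
      by (intro has_derivative_compose[OF Ck_on_SucD[OF Suc.prems(1) x]] Ck_on_SucD[OF Suc.prems(2)])
    then show "((\<lambda>x. g (f x)) has_derivative (\<lambda>h. \<Sum>b\<in>Basis. (partial_deriv h f x \<bullet> b) *\<^sub>R partial_deriv b g (f x))) (at x)"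
      by (rule has_derivative_eq_rhs) (rule ext, rule lin[OF \<open>f x \<in> T\<close>])
  next
    fix e :: 'a assume e: "e \<in> Basis"
    show "Ck_on k (\<lambda>x. \<Sum>b\<in>Basis. (partial_deriv e f x \<bullet> b) *\<^sub>R partial_deriv b g (f x)) S"
      using Suc.prems e
      by (intro Ck_on_sum S Ck_on_bilinear[OF bounded_bilinear_scaleR]
          Ck_on_linear_comp[OF bounded_linear_inner_left] Suc.IH Ck_on_Suc_imp[OF Suc.prems(1)]) simp_all
  qed
qed

text \<open>The derivative of \<open>inverse\<close> is a polynomial in \<open>inverse\<close>
  itself, so each order of differentiability yields the next.\<close>

lemma Ck_on_inverse_real: "Ck_on k (inverse :: real \<Rightarrow> real) (- {0})"
proof (induction k)
  case (Suc k)
  show ?case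
  proof (rule Ck_on_SucI)
    show "(inverse has_derivative (\<lambda>h. - (inverse x * h * inverse x))) (at x)" if "x \<in> - {0}" for x :: real
      using that by (intro has_derivative_inverse') auto
  qed (auto intro!: Ck_on_minus Ck_on_mult Suc Ck_on_const open_Compl)
qed (auto intro!: continuous_intros)

lemma Ck_on_divide:
  fixes f g :: "'a::euclidean_space \<Rightarrow> real"
  assumes "open S" "Ck_on k f S" "Ck_on k g S" "\<And>x. x \<in> S \<Longrightarrow> g x \<noteq> 0"
  shows "Ck_on k (\<lambda>x. f x / g x) S"
proof -
  have "Ck_on k (\<lambda>x. inverse (g x)) S"
    by (rule Ck_on_compose[OF assms(1) _ assms(3) Ck_on_inverse_real]) (use assms(4) in auto)
  then show ?thesis
    unfolding divide_inverse by (rule Ck_on_mult[OF assms(1,2)])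
qed

text \<open>The derivative as a point of a normed space, so that it can be differentiated again and
  estimated in operator norm. The basis expansion lets it inherit regularity from the partial
  derivatives.\<close>

definition deriv_blinfun :: "('a::euclidean_space \<Rightarrow> 'b::real_normed_vector) \<Rightarrow> 'a \<Rightarrow> 'a \<Rightarrow>\<^sub>L 'b"
  where "deriv_blinfun f x = (\<Sum>b\<in>Basis. blinfun_scaleR_left (partial_deriv b f x) o\<^sub>L blinfun_inner_right b)"

lemma has_derivative_deriv_blinfun:
  assumes "Ck_on (Suc k) f S" "x \<in> S"
  shows "(f has_derivative blinfun_apply (deriv_blinfun f x)) (at x)"
proof -
  have l: "linear (\<lambda>h. partial_deriv h f x)"
    using Ck_on_SucD[OF assms] by (rule has_derivative_linear)
  have "partial_deriv h f x = blinfun_apply (deriv_blinfun f x) h" for h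
  proof -
    have "partial_deriv h f x = partial_deriv (\<Sum>b\<in>Basis. (h \<bullet> b) *\<^sub>R b) f x"
      by (simp only: euclidean_representation)
    also have "\<dots> = (\<Sum>b\<in>Basis. (h \<bullet> b) *\<^sub>R partial_deriv b f x)"
      by (simp only: linear_sum[OF l] linear_scale[OF l])
    finally show ?thesis
      by (simp add: deriv_blinfun_def blinfun.sum_left inner_commute)
  qed
  then show ?thesis using Ck_on_SucD[OF assms] by simp
qed

lemma Ck_on_deriv_blinfun:
  assumes S: "open S" and "Ck_on (Suc k) f S"
  shows "Ck_on k (deriv_blinfun f) S"
  unfolding deriv_blinfun_def[abs_def]
proof (intro Ck_on_sum S)
  fix b :: 'a assume b: "b \<in> Basis"
  have "bounded_linear (\<lambda>v. blinfun_scaleR_left v o\<^sub>L blinfun_inner_right b)"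
    by (rule bounded_linear_compose[OF bounded_bilinear.bounded_linear_left[OF bounded_bilinear_blinfun_compose]
        bounded_linear_blinfun_scaleR_left])
  then show "Ck_on k (\<lambda>x. blinfun_scaleR_left (partial_deriv b f x) o\<^sub>L blinfun_inner_right b) S"
    by (rule Ck_on_linear_comp[OF _ S]) (use assms b in simp)
qed

lemma Ck_on_imp_lipschitz:
  fixes f :: "'a::euclidean_space \<Rightarrow> 'b::banach"
  assumes "open S" "Ck_on (Suc 0) f S" "cball x r \<subseteq> S"
  obtains L where "L-lipschitz_on (cball x r) f"
proof -
  have "continuous_on (cball x r) (deriv_blinfun f)"
    using Ck_on_deriv_blinfun[OF assms(1,2)] assms(3) by (auto intro: continuous_on_subset)
  then have "bounded (deriv_blinfun f ` cball x r)"
    by (intro compact_imp_bounded compact_continuous_image compact_cball)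
  then obtain L where "\<forall>A\<in>deriv_blinfun f ` cball x r. norm A \<le> L" unfolding bounded_iff ..
  then have L: "norm (deriv_blinfun f y) \<le> L" if "y \<in> cball x r" for y using that by blast
  have "(max L 0)-lipschitz_on (cball x r) f"
  proof (rule bounded_derivative_imp_lipschitz[where f' = "\<lambda>y. blinfun_apply (deriv_blinfun f y)"])
    show "(f has_derivative blinfun_apply (deriv_blinfun f y)) (at y within cball x r)" if "y \<in> cball x r" for y
      by (rule has_derivative_at_withinI, rule has_derivative_deriv_blinfun[OF assms(2)]) (use that assms(3) in auto)
    show "onorm (blinfun_apply (deriv_blinfun f y)) \<le> max L 0" if "y \<in> cball x r" for y
      using L[OF that] by (simp add: norm_blinfun.rep_eq)
  qed auto
  then show ?thesis by (rule that)
qed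

section \<open>Symmetry of second derivatives\<close>

lemma second_difference:
  fixes f :: "'a::real_normed_vector \<Rightarrow> real"
  assumes f: "\<And>y. y \<in> S \<Longrightarrow> (f has_derivative blinfun_apply (f' y)) (at y)"
    and f': "\<And>y. y \<in> S \<Longrightarrow> (f' has_derivative blinfun_apply (f'' y)) (at y)"
    and t: "0 < t" and S: "\<And>\<xi> \<eta>. 0 \<le> \<xi> \<Longrightarrow> \<xi> \<le> t \<Longrightarrow> 0 \<le> \<eta> \<Longrightarrow> \<eta> \<le> t \<Longrightarrow> x + \<xi> *\<^sub>R a + \<eta> *\<^sub>R b \<in> S"
  obtains \<xi> \<eta> where "0 < \<xi>" "\<xi> < t" "0 < \<eta>" "\<eta> < t"
    "f (x + t *\<^sub>R a + t *\<^sub>R b) - f (x + t *\<^sub>R a) - f (x + t *\<^sub>R b) + f x =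
      t\<^sup>2 * blinfun_apply (blinfun_apply (f'' (x + \<xi> *\<^sub>R a + \<eta> *\<^sub>R b)) b) a"
proof -
  have d: "((\<lambda>s. f (x + s *\<^sub>R a + c *\<^sub>R b)) has_real_derivative blinfun_apply (f' (x + s *\<^sub>R a + c *\<^sub>R b)) a) (at s)"
    if "0 \<le> s" "s \<le> t" "0 \<le> c" "c \<le> t" for s c
  proof -
    have "((\<lambda>s. x + s *\<^sub>R a + c *\<^sub>R b) has_derivative (\<lambda>h. h *\<^sub>R a)) (at s)"
      by (auto intro!: derivative_eq_intros)
    from has_derivative_compose[OF this f[OF S[OF that]]]
    show ?thesis
      unfolding has_field_derivative_def
      by (rule has_derivative_eq_rhs) (auto simp: blinfun.scaleR_right)
  qed
  \<comment> \<open>The mean value theorem is applied to the increment along \<open>b\<close>,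
    viewed as a function of the position along \<open>a\<close>; a second application then runs
    along \<open>b\<close>.\<close>
  have "\<exists>\<xi>. 0 < \<xi> \<and> \<xi> < t \<and> (f (x + t *\<^sub>R a + t *\<^sub>R b) - f (x + t *\<^sub>R a + 0 *\<^sub>R b))
      - (f (x + 0 *\<^sub>R a + t *\<^sub>R b) - f (x + 0 *\<^sub>R a + 0 *\<^sub>R b))
      = (t - 0) * (blinfun_apply (f' (x + \<xi> *\<^sub>R a + t *\<^sub>R b)) a - blinfun_apply (f' (x + \<xi> *\<^sub>R a + 0 *\<^sub>R b)) a)"
    by (rule MVT2[OF t]) (intro DERIV_diff d, use t in auto)
  then obtain \<xi> where \<xi>: "0 < \<xi>" "\<xi> < t" "(f (x + t *\<^sub>R a + t *\<^sub>R b) - f (x + t *\<^sub>R a))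
      - (f (x + t *\<^sub>R b) - f x) = t * (blinfun_apply (f' (x + \<xi> *\<^sub>R a + t *\<^sub>R b)) a - blinfun_apply (f' (x + \<xi> *\<^sub>R a)) a)"
    by auto
  have d': "((\<lambda>s. blinfun_apply (f' (x + \<xi> *\<^sub>R a + s *\<^sub>R b)) a) has_real_derivative
      blinfun_apply (blinfun_apply (f'' (x + \<xi> *\<^sub>R a + s *\<^sub>R b)) b) a) (at s)" if "0 \<le> s" "s \<le> t" for s
  proof -
    have y: "x + \<xi> *\<^sub>R a + s *\<^sub>R b \<in> S" using \<xi> that by (intro S) auto
    have "((\<lambda>s. x + \<xi> *\<^sub>R a + s *\<^sub>R b) has_derivative (\<lambda>h. h *\<^sub>R b)) (at s)"
      by (auto intro!: derivative_eq_intros)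
    from has_derivative_compose[OF this f'[OF y]]
    have "((\<lambda>s. blinfun_apply (f' (x + \<xi> *\<^sub>R a + s *\<^sub>R b)) a) has_derivative
        (\<lambda>h. blinfun_apply (blinfun_apply (f'' (x + \<xi> *\<^sub>R a + s *\<^sub>R b)) (h *\<^sub>R b)) a)) (at s)"
      by (rule bounded_linear.has_derivative[OF blinfun.bounded_linear_left])
    then show ?thesis
      unfolding has_field_derivative_def
      by (rule has_derivative_eq_rhs) (auto simp: blinfun.bilinear_simps)
  qed
  have "\<exists>\<eta>. 0 < \<eta> \<and> \<eta> < t \<and> blinfun_apply (f' (x + \<xi> *\<^sub>R a + t *\<^sub>R b)) a - blinfun_apply (f' (x + \<xi> *\<^sub>R a + 0 *\<^sub>R b)) a
      = (t - 0) * blinfun_apply (blinfun_apply (f'' (x + \<xi> *\<^sub>R a + \<eta> *\<^sub>R b)) b) a"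
    by (rule MVT2[OF t]) (intro d', auto)
  then obtain \<eta> where "0 < \<eta>" "\<eta> < t" "blinfun_apply (f' (x + \<xi> *\<^sub>R a + t *\<^sub>R b)) a - blinfun_apply (f' (x + \<xi> *\<^sub>R a)) a
      = t * blinfun_apply (blinfun_apply (f'' (x + \<xi> *\<^sub>R a + \<eta> *\<^sub>R b)) b) a"
    by auto
  with \<xi> show ?thesis
    by (intro that[of \<xi> \<eta>]) (auto simp: power2_eq_square algebra_simps)
qed

text \<open>The second difference is unchanged when \<open>a\<close> and \<open>b\<close> are
  exchanged. By \<open>second_difference\<close> it equals either mixed derivative at some point
  near \<open>x\<close>, and continuity moves both points to \<open>x\<close>.\<close>

lemma second_derivative_symmetric_real:
  fixes f :: "'a::real_normed_vector \<Rightarrow> real"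
  assumes S: "open S" "x \<in> S"
    and f: "\<And>y. y \<in> S \<Longrightarrow> (f has_derivative blinfun_apply (f' y)) (at y)"
    and f': "\<And>y. y \<in> S \<Longrightarrow> (f' has_derivative blinfun_apply (f'' y)) (at y)"
    and cont: "continuous_on S f''"
  shows "blinfun_apply (blinfun_apply (f'' x) a) b = blinfun_apply (blinfun_apply (f'' x) b) a"
proof (rule ccontr)
  let ?F = "\<lambda>y. blinfun_apply (blinfun_apply (f'' y) a) b" and ?G = "\<lambda>y. blinfun_apply (blinfun_apply (f'' y) b) a"
  assume ne: "?F x \<noteq> ?G x"
  define e where "e = \<bar>?F x - ?G x\<bar> / 2"
  have e: "0 < e" using ne by (simp add: e_def)
  have cF: "continuous_on S ?F" "continuous_on S ?G" by (intro continuous_intros cont)+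
  from cF S have "isCont ?F x" "isCont ?G x" by (auto simp: continuous_on_eq_continuous_at)
  then have "(?F \<longlongrightarrow> ?F x) (nhds x)" "(?G \<longlongrightarrow> ?G x) (nhds x)"
    by (simp_all only: isCont_def tendsto_at_iff_tendsto_nhds[of ?F x] tendsto_at_iff_tendsto_nhds[of ?G x])
  then have "eventually (\<lambda>y. dist (?F y) (?F x) < e) (nhds x)" "eventually (\<lambda>y. dist (?G y) (?G x) < e) (nhds x)"
    using tendstoD[OF _ e] by blast+
  then have "eventually (\<lambda>y. dist (?F y) (?F x) < e \<and> dist (?G y) (?G x) < e \<and> y \<in> S) (nhds x)"
    using S by (intro eventually_conj eventually_nhds_in_open)
  then obtain d where d: "0 < d" "\<And>y. dist y x < d \<Longrightarrow> dist (?F y) (?F x) < e \<and> dist (?G y) (?G x) < e \<and> y \<in> S"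
    by (auto simp: eventually_nhds_metric)
  define m where "m = norm a + norm b + 1"
  \<comment> \<open>Steps of this length keep the whole parallelogram spanned at \<open>x\<close>
    within distance \<open>d\<close>.\<close>
  define t where "t = d / (2 * m)"
  have pos: "0 < m" unfolding m_def using norm_ge_zero[of a] norm_ge_zero[of b] by linarith
  have t: "0 < t" using d pos by (simp add: t_def)
  have near: "dist (x + \<xi> *\<^sub>R u + \<eta> *\<^sub>R v) x < d"
    if "0 \<le> \<xi>" "\<xi> \<le> t" "0 \<le> \<eta>" "\<eta> \<le> t" "norm u + norm v = norm a + norm b" for \<xi> \<eta> u v
  proof -
    have "dist (x + \<xi> *\<^sub>R u + \<eta> *\<^sub>R v) x = norm (\<xi> *\<^sub>R u + \<eta> *\<^sub>R v)" by (simp add: dist_norm add.assoc)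
    also have "\<dots> \<le> \<xi> * norm u + \<eta> * norm v" using norm_triangle_ineq[of "\<xi> *\<^sub>R u" "\<eta> *\<^sub>R v"] that by simp
    also have "\<dots> \<le> t * norm u + t * norm v" using that by (intro add_mono mult_right_mono) auto
    also have "\<dots> = t * (norm a + norm b)" by (simp add: that(5)[symmetric] algebra_simps)
    also have "\<dots> \<le> t * m" using t by (simp add: m_def)
    also have "\<dots> < d" using d pos by (simp add: t_def)
    finally show ?thesis .
  qed
  obtain \<xi> \<eta> where 1: "0 < \<xi>" "\<xi> < t" "0 < \<eta>" "\<eta> < t"
    "f (x + t *\<^sub>R a + t *\<^sub>R b) - f (x + t *\<^sub>R a) - f (x + t *\<^sub>R b) + f x = t\<^sup>2 * ?G (x + \<xi> *\<^sub>R a + \<eta> *\<^sub>R b)"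
    by (rule second_difference[OF f f' t, where x = x and a = a and b = b]) (use near d in auto)
  obtain \<xi>' \<eta>' where 2: "0 < \<xi>'" "\<xi>' < t" "0 < \<eta>'" "\<eta>' < t"
    "f (x + t *\<^sub>R b + t *\<^sub>R a) - f (x + t *\<^sub>R b) - f (x + t *\<^sub>R a) + f x = t\<^sup>2 * ?F (x + \<xi>' *\<^sub>R b + \<eta>' *\<^sub>R a)"
    by (rule second_difference[OF f f' t, where x = x and a = b and b = a]) (use near d in \<open>auto simp: add.commute\<close>)
  have sw: "x + t *\<^sub>R b + t *\<^sub>R a = x + t *\<^sub>R a + t *\<^sub>R b" by (simp add: ac_simps)
  have "t\<^sup>2 * ?F (x + \<xi>' *\<^sub>R b + \<eta>' *\<^sub>R a) = t\<^sup>2 * ?G (x + \<xi> *\<^sub>R a + \<eta> *\<^sub>R b)"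
    using 1(5) 2(5) unfolding sw by linarith
  then have "?F (x + \<xi>' *\<^sub>R b + \<eta>' *\<^sub>R a) = ?G (x + \<xi> *\<^sub>R a + \<eta> *\<^sub>R b)" using t by simp
  moreover have "dist (?F (x + \<xi>' *\<^sub>R b + \<eta>' *\<^sub>R a)) (?F x) < e"
    using d(2)[OF near[of \<xi>' \<eta>' b a]] 2 by simp
  moreover have "dist (?G (x + \<xi> *\<^sub>R a + \<eta> *\<^sub>R b)) (?G x) < e"
    using d(2)[OF near[of \<xi> \<eta> a b]] 1 by simp
  ultimately have "\<bar>?F x - ?G x\<bar> < 2 * e" unfolding dist_real_def by linarith
  then show False by (simp add: e_def)
qed

lemma second_derivative_symmetric:
  fixes f :: "'a::euclidean_space \<Rightarrow> 'b::euclidean_space"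
  assumes S: "open S" "x \<in> S" and f: "Ck_on 2 f S"
  shows "blinfun_apply (blinfun_apply (deriv_blinfun (deriv_blinfun f) x) a) b =
    blinfun_apply (blinfun_apply (deriv_blinfun (deriv_blinfun f) x) b) a"
proof (rule euclidean_eqI)
  fix c :: 'b
  let ?L = "\<lambda>A. blinfun_inner_right c o\<^sub>L A"
  have f2: "Ck_on (Suc (Suc 0)) f S" using f by (simp add: numeral_2_eq_2)
  note f1 = Ck_on_deriv_blinfun[OF S(1) f2]
  have L: "bounded_linear ?L"
    by (rule bounded_bilinear.bounded_linear_right[OF bounded_bilinear_blinfun_compose])
  have "blinfun_apply (blinfun_apply (Blinfun ?L o\<^sub>L deriv_blinfun (deriv_blinfun f) x) a) b =
      blinfun_apply (blinfun_apply (Blinfun ?L o\<^sub>L deriv_blinfun (deriv_blinfun f) x) b) a"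
  proof (rule second_derivative_symmetric_real[OF S, of "\<lambda>y. c \<bullet> f y" "\<lambda>y. ?L (deriv_blinfun f y)"])
    show "((\<lambda>y. c \<bullet> f y) has_derivative blinfun_apply (?L (deriv_blinfun f y))) (at y)" if "y \<in> S" for y
      by (rule has_derivative_eq_rhs[OF bounded_linear.has_derivative[OF bounded_linear_inner_right has_derivative_deriv_blinfun[OF f2 that]]])
        (simp add: fun_eq_iff)
    show "((\<lambda>y. ?L (deriv_blinfun f y)) has_derivative
        blinfun_apply (Blinfun ?L o\<^sub>L deriv_blinfun (deriv_blinfun f) y)) (at y)" if "y \<in> S" for y
      by (rule has_derivative_eq_rhs[OF bounded_linear.has_derivative[OF L has_derivative_deriv_blinfun[OF f1 that]]])
        (simp add: fun_eq_iff bounded_linear_Blinfun_apply[OF L])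
    show "continuous_on S (\<lambda>y. Blinfun ?L o\<^sub>L deriv_blinfun (deriv_blinfun f) y)"
      using Ck_on_deriv_blinfun[OF S(1) f1] by (intro continuous_intros) simp
  qed
  then show "blinfun_apply (blinfun_apply (deriv_blinfun (deriv_blinfun f) x) a) b \<bullet> c =
    blinfun_apply (blinfun_apply (deriv_blinfun (deriv_blinfun f) x) b) a \<bullet> c"
    by (simp add: bounded_linear_Blinfun_apply[OF L] inner_commute)
qed

section \<open>Coordinate invariance of the harmonic map equation\<close>

lemma bounded_bilinear_matrix_vector_mult:
  "bounded_bilinear ((*v) :: real ^ 'n ^ 'm \<Rightarrow> real ^ 'n \<Rightarrow> real ^ 'm)"
  unfolding bilinear_conv_bounded_bilinear[symmetric] bilinear_def
  by (auto intro!: linearI simp: matrix_vector_mult_add_rdistrib matrix_vector_right_distrib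
      scaleR_matrix_vector_assoc matrix_vector_mult_scaleR)

text \<open>The Euler-Lagrange equation of the energy tested with the vector \<open>l\<close>, where \<open>dm\<close> is the derivative of the
  metric \<open>m\<close> and \<open>w\<close>, \<open>P\<close>, \<open>Q\<close> stand for \<open>\<Delta>u\<close>, \<open>u\<^sub>x\<close>, \<open>u\<^sub>y\<close>.\<close>

definition euler_lagrange ::
    "real ^ 'n ^ 'n \<Rightarrow> (real ^ 'n \<Rightarrow> real ^ 'n ^ 'n) \<Rightarrow> real ^ 'n \<Rightarrow> real ^ 'n \<Rightarrow> real ^ 'n \<Rightarrow> real ^ 'n::finite \<Rightarrow> real"
  where "euler_lagrange m dm w P Q l = l \<bullet> (m *v w)
    + (l \<bullet> (dm P *v P) - (P \<bullet> (dm l *v P)) / 2) + (l \<bullet> (dm Q *v Q) - (Q \<bullet> (dm l *v Q)) / 2)"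

text \<open>Both sides of the pullback formula are differentiated at \<open>x\<close> and compared
  by uniqueness of the derivative. The three terms come from \<open>J a\<close>, the metric
  \<open>m'\<close> along \<tau>, and \<open>J b\<close>.\<close>

lemma metric_pullback_deriv:
  fixes \<tau> :: "real ^ 'n \<Rightarrow> real ^ 'n::finite"
  assumes U: "open U" "x \<in> U"
    and m: "\<And>y a b. y \<in> U \<Longrightarrow> a \<bullet> (m y *v b) = blinfun_apply (J y) a \<bullet> (m' (\<tau> y) *v blinfun_apply (J y) b)"
    and \<tau>: "(\<tau> has_derivative blinfun_apply (J x)) (at x)"
    and J: "(J has_derivative blinfun_apply J') (at x)"
    and dm: "(m has_derivative dm) (at x)" and dm': "(m' has_derivative dm') (at (\<tau> x))"
  shows "a \<bullet> (dm h *v b) = blinfun_apply (blinfun_apply J' h) a \<bullet> (m' (\<tau> x) *v blinfun_apply (J x) b)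
    + blinfun_apply (J x) a \<bullet> (dm' (blinfun_apply (J x) h) *v blinfun_apply (J x) b)
    + blinfun_apply (J x) a \<bullet> (m' (\<tau> x) *v blinfun_apply (blinfun_apply J' h) b)"
proof -
  note mv = bounded_bilinear.FDERIV[OF bounded_bilinear_matrix_vector_mult]
  have J_app: "((\<lambda>y. blinfun_apply (J y) v) has_derivative (\<lambda>h. blinfun_apply (blinfun_apply J' h) v)) (at x)" for v
    by (rule bounded_linear.has_derivative[OF blinfun.bounded_linear_left J])
  have 1: "((\<lambda>y. a \<bullet> (m y *v b)) has_derivative (\<lambda>h. a \<bullet> (m x *v 0 + dm h *v b) + 0 \<bullet> (m x *v b))) (at x)"
    by (intro has_derivative_inner mv dm has_derivative_const)
  have 2: "((\<lambda>y. blinfun_apply (J y) a \<bullet> (m' (\<tau> y) *v blinfun_apply (J y) b)) has_derivative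
     (\<lambda>h. blinfun_apply (J x) a \<bullet> (m' (\<tau> x) *v blinfun_apply (blinfun_apply J' h) b
          + dm' (blinfun_apply (J x) h) *v blinfun_apply (J x) b)
        + blinfun_apply (blinfun_apply J' h) a \<bullet> (m' (\<tau> x) *v blinfun_apply (J x) b))) (at x)"
    by (intro has_derivative_inner mv J_app has_derivative_compose[OF \<tau> dm'])
  have "((\<lambda>y. a \<bullet> (m y *v b)) has_derivative
     (\<lambda>h. blinfun_apply (J x) a \<bullet> (m' (\<tau> x) *v blinfun_apply (blinfun_apply J' h) b
          + dm' (blinfun_apply (J x) h) *v blinfun_apply (J x) b)
        + blinfun_apply (blinfun_apply J' h) a \<bullet> (m' (\<tau> x) *v blinfun_apply (J x) b))) (at x)"
    by (rule has_derivative_transform_within_open[OF 2 U]) (simp add: m)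
  from fun_cong[OF has_derivative_unique[OF 1 this], of h]
  show ?thesis by (simp add: inner_add_right)
qed

text \<open>Torsion-freeness enters as the symmetry of the second derivative \<open>J'\<close>, which makes its two
  contributions to \<open>dm l\<close> cancel against those to \<open>dm P\<close>.\<close>

lemma euler_lagrange_transform:
  fixes \<tau> :: "real ^ 'n \<Rightarrow> real ^ 'n::finite"
  assumes U: "open U" "x \<in> U"
    and m: "\<And>y a b. y \<in> U \<Longrightarrow> a \<bullet> (m y *v b) = blinfun_apply (J y) a \<bullet> (m' (\<tau> y) *v blinfun_apply (J y) b)"
    and \<tau>: "(\<tau> has_derivative blinfun_apply (J x)) (at x)"
    and J: "(J has_derivative blinfun_apply J') (at x)"
    and sym: "\<And>a b. blinfun_apply (blinfun_apply J' a) b = blinfun_apply (blinfun_apply J' b) a"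
    and dm: "(m has_derivative dm) (at x)" and dm': "(m' has_derivative dm') (at (\<tau> x))"
    and sym_m: "\<And>a b. a \<bullet> (m' (\<tau> x) *v b) = b \<bullet> (m' (\<tau> x) *v a)"
  shows "euler_lagrange (m x) dm w P Q l = euler_lagrange (m' (\<tau> x)) dm'
    (blinfun_apply (J x) w + blinfun_apply (blinfun_apply J' P) P + blinfun_apply (blinfun_apply J' Q) Q)
    (blinfun_apply (J x) P) (blinfun_apply (J x) Q) (blinfun_apply (J x) l)"
proof -
  have D: "a \<bullet> (dm h *v b) = blinfun_apply (blinfun_apply J' h) a \<bullet> (m' (\<tau> x) *v blinfun_apply (J x) b)
    + blinfun_apply (J x) a \<bullet> (dm' (blinfun_apply (J x) h) *v blinfun_apply (J x) b)
    + blinfun_apply (J x) a \<bullet> (m' (\<tau> x) *v blinfun_apply (blinfun_apply J' h) b)" for a b h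
    by (rule metric_pullback_deriv[OF U m \<tau> J dm dm'])
  \<comment> \<open>The surviving term with \<open>J'\<close> applied twice to \<open>R\<close> is
    the correction that the chain rule adds to the Laplacian in the new coordinates.\<close>
  have half: "l \<bullet> (dm R *v R) - (R \<bullet> (dm l *v R)) / 2 =
      blinfun_apply (J x) l \<bullet> (m' (\<tau> x) *v blinfun_apply (blinfun_apply J' R) R)
      + (blinfun_apply (J x) l \<bullet> (dm' (blinfun_apply (J x) R) *v blinfun_apply (J x) R)
      - (blinfun_apply (J x) R \<bullet> (dm' (blinfun_apply (J x) l) *v blinfun_apply (J x) R)) / 2)" for R
    using D[of l R R] D[of R l R] sym_m[of "blinfun_apply (J x) R" "blinfun_apply (blinfun_apply J' R) l"]
    unfolding sym[of l R] by argo
  show ?thesis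
    unfolding euler_lagrange_def half m[OF U(2)]
    by (simp add: matrix_vector_right_distrib inner_add_right)
qed

section \<open>Christoffel symbols and the tested equation\<close>

lemma euclidean_vec_eq_sum: "x = (\<Sum>i\<in>UNIV. axis i (x $ i))" for x :: "'b::comm_monoid_add ^ 'n::finite"
  by (simp add: vec_eq_iff axis_def sum.delta if_distrib[where f = "\<lambda>f. f _"] cong: if_cong)

lemma vec_eq_sum_axis: "(x :: real ^ 'n::finite) = (\<Sum>i\<in>UNIV. (x $ i) *\<^sub>R axis i 1)"
  using basis_expansion[of x] by (simp add: scalar_mult_eq_scaleR)

text \<open>The Christoffel symbols of the first kind contracted twice with \<open>P\<close>. Two of
  their three metric derivatives coincide after the contraction, hence one full term and one half
  term.\<close>

definition christoffel_vec ::
    "(real ^ 'n \<Rightarrow> real ^ 'n ^ 'n) \<Rightarrow> real ^ 'n \<Rightarrow> real ^ 'n::finite"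
  where "christoffel_vec dm P = dm P *v P - (1/2) *\<^sub>R (\<chi> l. P \<bullet> (dm (axis l 1) *v P))"

lemma inner_christoffel_vec:
  assumes "linear dm"
  shows "l \<bullet> christoffel_vec dm P = l \<bullet> (dm P *v P) - (P \<bullet> (dm l *v P)) / 2"
proof -
  have lin: "linear (\<lambda>l. P \<bullet> (dm l *v P))"
    using assms by (auto intro!: linearI simp: linear_add linear_scale matrix_vector_mult_add_rdistrib
        inner_add_right scaleR_matrix_vector_assoc[symmetric])
  have "P \<bullet> (dm l *v P) = P \<bullet> (dm (\<Sum>i\<in>UNIV. (l $ i) *\<^sub>R axis i 1) *v P)"
    using vec_eq_sum_axis[of l] by simp
  also have "\<dots> = (\<Sum>i\<in>UNIV. (l $ i) * (P \<bullet> (dm (axis i 1) *v P)))"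
    by (simp only: linear_sum[OF lin] linear_scale[OF lin] real_scaleR_def)
  finally show ?thesis
    by (simp add: christoffel_vec_def inner_diff_right inner_vec_def[of l "vec_lambda _"])
qed

lemma christoffel_sum:
  fixes A :: "('a, 'n::finite) chart set"
  assumes dm: "(metric_matrix A g c has_derivative dm) (at x)"
  shows "(\<Sum>b\<in>UNIV. \<Sum>k\<in>UNIV. christoffel A g c a b k x * (P $ b * P $ k)) =
    (matrix_inv (metric_matrix A g c x) *v christoffel_vec dm P) $ a"
proof -
  have lin: "linear dm" using dm by (rule has_derivative_linear)
  have pd: "partial_deriv e (\<lambda>y. metric_matrix A g c y $ i $ j) x = dm e $ i $ j" for e i j
    by (rule partial_deriv_eq)
      (intro bounded_linear.has_derivative[OF bounded_linear_vec_nth] dm)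
  have comp: "dm P $ i $ j = (\<Sum>b\<in>UNIV. P $ b * dm (axis b 1) $ i $ j)" for i j
  proof -
    have "dm P = dm (\<Sum>b\<in>UNIV. (P $ b) *\<^sub>R axis b 1)" using vec_eq_sum_axis[of P] by simp
    also have "\<dots> = (\<Sum>b\<in>UNIV. (P $ b) *\<^sub>R dm (axis b 1))"
      by (simp only: linear_sum[OF lin] linear_scale[OF lin])
    finally show ?thesis by simp
  qed
  have S1: "(dm P *v P) $ l = (\<Sum>b\<in>UNIV. \<Sum>k\<in>UNIV. dm (axis b 1) $ l $ k * (P $ b * P $ k))" for l
    unfolding matrix_vector_mult_def vec_lambda_beta comp sum_distrib_right
    by (subst sum.swap) (simp add: mult_ac)
  \<comment> \<open>The summation indices are exchanged, which the symmetric factor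
    \<open>P $ b * P $ k\<close> permits; this identifies the first two metric derivatives.\<close>
  have S2: "(dm P *v P) $ l = (\<Sum>b\<in>UNIV. \<Sum>k\<in>UNIV. dm (axis k 1) $ l $ b * (P $ b * P $ k))" for l
    unfolding S1 by (subst sum.swap) (simp add: mult_ac)
  have S3: "P \<bullet> (dm e *v P) = (\<Sum>b\<in>UNIV. \<Sum>k\<in>UNIV. dm e $ b $ k * (P $ b * P $ k))" for e
    by (simp add: inner_vec_def matrix_vector_mult_def sum_distrib_left mult_ac)
  have L: "christoffel_vec dm P $ l = (\<Sum>b\<in>UNIV. \<Sum>k\<in>UNIV.
      (1/2) * (dm (axis b 1) $ l $ k + dm (axis k 1) $ l $ b - dm (axis l 1) $ b $ k) * (P $ b * P $ k))" for l
  proof -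
    have "christoffel_vec dm P $ l = (1/2) * ((dm P *v P) $ l + (dm P *v P) $ l - P \<bullet> (dm (axis l 1) *v P))"
      by (simp add: christoffel_vec_def)
    also have "\<dots> = (1/2) * ((\<Sum>b\<in>UNIV. \<Sum>k\<in>UNIV. dm (axis b 1) $ l $ k * (P $ b * P $ k))
        + (\<Sum>b\<in>UNIV. \<Sum>k\<in>UNIV. dm (axis k 1) $ l $ b * (P $ b * P $ k))
        - (\<Sum>b\<in>UNIV. \<Sum>k\<in>UNIV. dm (axis l 1) $ b $ k * (P $ b * P $ k)))"
      by (simp only: S1[symmetric] S2[symmetric] S3)
    finally show ?thesis
      by (simp add: sum.distrib[symmetric] sum_subtractf[symmetric] sum_distrib_left algebra_simps)
  qed
  show ?thesis
    unfolding christoffel_def pd matrix_vector_mult_def[of "matrix_inv _"] vec_lambda_beta L sum_distrib_left sum_distrib_right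
    by (rule trans[OF sum.cong[OF refl sum.swap] trans[OF sum.swap]]) (simp add: mult_ac)
qed

lemma matrix_inv_mult:
  fixes A :: "real ^ 'n ^ 'n::finite"
  assumes "invertible A"
  shows "A ** matrix_inv A = mat 1" "matrix_inv A ** A = mat 1"
  using someI_ex[OF assms[unfolded invertible_def]] by (auto simp: matrix_inv_def)

text \<open>The invertible metric matrix lowers the index, and a vector vanishes if its inner
  product with every test vector does. This links the coordinate equation of
  \<open>harmonic_on_disk\<close> to the invariant form.\<close>

lemma tension_zero_iff:
  fixes A :: "('a, 'n::finite) chart set"
  assumes dm: "(metric_matrix A g c has_derivative dm) (at x)"
    and inv: "invertible (metric_matrix A g c x)"
  shows "(\<forall>a. w $ a + (\<Sum>b\<in>UNIV. \<Sum>k\<in>UNIV. christoffel A g c a b k x * (P $ b * P $ k + Q $ b * Q $ k)) = 0)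
    \<longleftrightarrow> (\<forall>l. euler_lagrange (metric_matrix A g c x) dm w P Q l = 0)"
proof -
  let ?M = "metric_matrix A g c x" and ?L = "christoffel_vec dm P + christoffel_vec dm Q"
  have "(\<forall>a. w $ a + (\<Sum>b\<in>UNIV. \<Sum>k\<in>UNIV. christoffel A g c a b k x * (P $ b * P $ k + Q $ b * Q $ k)) = 0)
      \<longleftrightarrow> w + matrix_inv ?M *v ?L = 0"
    by (simp add: vec_eq_iff distrib_left sum.distrib christoffel_sum[OF dm] matrix_vector_right_distrib)
  also have "\<dots> \<longleftrightarrow> ?M *v w + ?L = 0"
  proof
    assume "w + matrix_inv ?M *v ?L = 0"
    then have "?M *v (w + matrix_inv ?M *v ?L) = 0" by simp
    then show "?M *v w + ?L = 0"
      by (simp add: matrix_vector_right_distrib matrix_vector_mul_assoc matrix_inv_mult[OF inv])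
  next
    assume "?M *v w + ?L = 0"
    then have "matrix_inv ?M *v (?M *v w + ?L) = 0" by simp
    then show "w + matrix_inv ?M *v ?L = 0"
      by (simp add: matrix_vector_right_distrib matrix_vector_mul_assoc matrix_inv_mult[OF inv])
  qed
  also have "\<dots> \<longleftrightarrow> (\<forall>l. l \<bullet> (?M *v w + ?L) = 0)"
    by (metis inner_eq_zero_iff inner_zero_right)
  also have "\<dots> \<longleftrightarrow> (\<forall>l. euler_lagrange ?M dm w P Q l = 0)"
    by (simp add: euler_lagrange_def inner_add_right inner_christoffel_vec[OF has_derivative_linear[OF dm]] algebra_simps)
  finally show ?thesis .
qed

section \<open>Regularity of the nonlinearity\<close>

lemma Ck_on_vecI:
  fixes f :: "'a::euclidean_space \<Rightarrow> 'b::euclidean_space ^ 'n::finite"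
  assumes S: "open S" and "\<And>i. Ck_on k (\<lambda>x. f x $ i) S"
  shows "Ck_on k f S"
proof -
  have "bounded_linear (axis i :: 'b \<Rightarrow> 'b ^ 'n)" for i
    unfolding linear_conv_bounded_linear[symmetric]
    by (auto intro!: linearI simp: vec_eq_iff axis_def)
  then have "Ck_on k (\<lambda>x. \<Sum>i\<in>UNIV. axis i (f x $ i)) S"
    by (intro Ck_on_sum S Ck_on_linear_comp[of "axis _"] assms)
  then show ?thesis using euclidean_vec_eq_sum[of "f _"] by simp
qed

lemma Ck_on_det:
  fixes m :: "'a::euclidean_space \<Rightarrow> real ^ 'n ^ 'n::finite"
  assumes S: "open S" and "\<And>i j. Ck_on k (\<lambda>x. m x $ i $ j) S"
  shows "Ck_on k (\<lambda>x. det (m x)) S"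
  unfolding det_def
  by (intro Ck_on_sum Ck_on_mult Ck_on_const Ck_on_prod S assms)

text \<open>Cramer's rule writes each entry of the inverse as a quotient of determinants, which are
  polynomials in the entries of \<open>m x\<close>.\<close>

lemma Ck_on_matrix_inv:
  fixes m :: "'a::euclidean_space \<Rightarrow> real ^ 'n ^ 'n::finite"
  assumes S: "open S" and m: "\<And>i j. Ck_on k (\<lambda>x. m x $ i $ j) S" and inv: "\<And>x. x \<in> S \<Longrightarrow> invertible (m x)"
  shows "Ck_on k (\<lambda>x. matrix_inv (m x) $ a $ l) S"
proof -
  let ?C = "\<lambda>x. (\<chi> i j. if j = a then axis l 1 $ i else m x $ i $ j) :: real ^ 'n ^ 'n"
  have "Ck_on k (\<lambda>x. det (?C x) / det (m x)) S"
  proof (intro Ck_on_divide S Ck_on_det m)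
    show "Ck_on k (\<lambda>x. ?C x $ i $ j) S" for i j
      using m[of i j] by (cases "j = a") (auto intro!: Ck_on_const S)
  qed (use inv in \<open>simp add: invertible_det_nz\<close>)
  then show ?thesis
  proof (rule Ck_on_cong[OF S, rotated])
    fix x assume x: "x \<in> S"
    have "m x *v (matrix_inv (m x) *v axis l 1) = axis l 1"
      by (simp add: matrix_vector_mul_assoc matrix_inv_mult[OF inv[OF x]])
    then have "matrix_inv (m x) *v axis l 1 = (\<chi> a. det (\<chi> i j. if j = a then axis l 1 $ i else m x $ i $ j) / det (m x))"
      using cramer[of "m x"] inv[OF x] by (simp add: invertible_det_nz)
    then show "det (?C x) / det (m x) = matrix_inv (m x) $ a $ l"
      by (simp add: matrix_vector_mult_basis column_def vec_eq_iff)
  qed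
qed

lemma Ck_on_christoffel:
  assumes S: "open S" and m: "\<And>i j. smooth_on (\<lambda>x. metric_matrix A g c x $ i $ j) S"
    and inv: "\<And>x. x \<in> S \<Longrightarrow> invertible (metric_matrix A g c x)"
  shows "Ck_on k (christoffel A g c a b d) S"
proof -
  have C: "Ck_on k (\<lambda>x. metric_matrix A g c x $ i $ j) S" for k i j
    using m by (simp add: smooth_on_def)
  have D: "Ck_on k (partial_deriv (axis e 1) (\<lambda>x. metric_matrix A g c x $ i $ j)) S" for e i j
    using C[of "Suc k" i j] by (simp add: axis_in_Basis_iff)
  show ?thesis
    unfolding christoffel_def[abs_def]
    by (intro Ck_on_mult Ck_on_const Ck_on_sum Ck_on_matrix_inv Ck_on_add Ck_on_diff D C S inv)
qed

text \<open>Supplies the hypotheses of \<open>local_solution\<close>: coefficients of class C^2 make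
  the derivative of \<open>H\<close> of class C^1, hence Lipschitz on a closed ball.\<close>

lemma quadratic_form_C1_lipschitz:
  fixes \<gamma> :: "'n \<Rightarrow> 'n \<Rightarrow> 'n \<Rightarrow> real ^ 'n \<Rightarrow> real" and U :: "(real ^ 'n::finite) set"
  assumes H_def: "H = (\<lambda>s. \<chi> a. \<Sum>b\<in>UNIV. \<Sum>k\<in>UNIV. \<gamma> a b k (fst s) *
    (fst (snd s) $ b * fst (snd s) $ k + snd (snd s) $ b * snd (snd s) $ k))"
    and U: "open U" and \<gamma>: "\<And>a b k. Ck_on 2 (\<gamma> a b k) U" and p: "p \<in> U"
  obtains r H' L where "0 < r" "cball p r \<subseteq> U"
    "\<And>s. s \<in> cball (p, 0, 0) r \<Longrightarrow> (H has_derivative blinfun_apply (H' s)) (at s)"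
    "L-lipschitz_on (cball (p, 0, 0) r) H'" "H (p, 0, 0) = 0" "H' (p, 0, 0) = 0"
proof -
  let ?S = "U \<times> (UNIV :: (real ^ 'n) set) \<times> (UNIV :: (real ^ 'n) set)"
  have S: "open ?S" by (intro open_Times U open_UNIV)
  have lin: "bounded_linear (\<lambda>s :: (real ^ 'n) \<times> (real ^ 'n) \<times> (real ^ 'n). fst (snd s) $ b)"
    "bounded_linear (\<lambda>s :: (real ^ 'n) \<times> (real ^ 'n) \<times> (real ^ 'n). snd (snd s) $ b)" for b
    by (intro bounded_linear_compose[OF bounded_linear_vec_nth] bounded_linear_fst_comp bounded_linear_snd_comp bounded_linear_ident)+
  have c\<gamma>: "Ck_on 2 (\<lambda>s. \<gamma> a b k (fst s)) ?S" for a b k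
    by (rule Ck_on_compose[OF S _ Ck_on_linear[OF bounded_linear_fst S] \<gamma>]) auto
  have "Ck_on 2 H ?S"
    unfolding H_def
    by (rule Ck_on_vecI[OF S], unfold vec_lambda_beta,
      intro Ck_on_sum Ck_on_mult Ck_on_add S c\<gamma> Ck_on_linear[OF lin(1)] Ck_on_linear[OF lin(2)])
  then have H2: "Ck_on (Suc (Suc 0)) H ?S" by (simp only: numeral_2_eq_2)
  obtain r where r: "0 < r" "cball p r \<subseteq> U"
    using open_contains_cball U p by blast
  have sub: "cball (p, 0, 0) r \<subseteq> ?S"
  proof
    fix s assume "s \<in> cball (p, 0 :: real ^ 'n, 0 :: real ^ 'n) r"
    then have "dist p (fst s) \<le> r" using dist_fst_le[of "(p, 0, 0)" s] by simp
    then show "s \<in> ?S" using r(2) by (auto simp: mem_Times_iff)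
  qed
  obtain L where L: "L-lipschitz_on (cball (p, 0, 0) r) (deriv_blinfun H)"
    using Ck_on_imp_lipschitz[OF S Ck_on_deriv_blinfun[OF S H2] sub] by blast
  have d: "(H has_derivative blinfun_apply (deriv_blinfun H s)) (at s)" if "s \<in> cball (p, 0, 0) r" for s
    using has_derivative_deriv_blinfun[OF H2] sub that by blast
  have s0: "(p, 0, 0) \<in> cball (p, 0 :: real ^ 'n, 0 :: real ^ 'n) r" using r by simp
  \<comment> \<open>Each summand is a coefficient times a quadratic expression, and the latter
    vanishes at the centre together with its derivative.\<close>
  have "((\<lambda>s. H s $ a) has_derivative (\<lambda>_. 0)) (at (p, 0, 0))" for a
  proof -
    have q: "((\<lambda>s. fst (snd s) $ b * fst (snd s) $ k + snd (snd s) $ b * snd (snd s) $ k) has_derivative (\<lambda>_. 0))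
        (at (p, 0 :: real ^ 'n, 0 :: real ^ 'n))" for b k
      by (rule has_derivative_eq_rhs[OF has_derivative_add[OF has_derivative_mult[OF
          bounded_linear_imp_has_derivative[OF lin(1)] bounded_linear_imp_has_derivative[OF lin(1)]]
          has_derivative_mult[OF bounded_linear_imp_has_derivative[OF lin(2)] bounded_linear_imp_has_derivative[OF lin(2)]]]])
        simp
    have g: "((\<lambda>s. \<gamma> a b k (fst s)) has_derivative blinfun_apply (deriv_blinfun (\<lambda>s. \<gamma> a b k (fst s)) (p, 0, 0)))
        (at (p, 0 :: real ^ 'n, 0 :: real ^ 'n))" for b k
      using has_derivative_deriv_blinfun[of 1 "\<lambda>s. \<gamma> a b k (fst s)" ?S "(p, 0, 0)"] c\<gamma>[of a b k] p
      by (simp only: numeral_2_eq_2 One_nat_def) simp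
    have t: "((\<lambda>s. \<gamma> a b k (fst s) * (fst (snd s) $ b * fst (snd s) $ k + snd (snd s) $ b * snd (snd s) $ k))
        has_derivative (\<lambda>_. 0)) (at (p, 0 :: real ^ 'n, 0 :: real ^ 'n))" for b k
      by (rule has_derivative_eq_rhs[OF has_derivative_mult[OF g q]]) simp
    show ?thesis
      unfolding H_def vec_lambda_beta
      by (rule has_derivative_eq_rhs[OF has_derivative_sum[OF has_derivative_sum[OF t]]]) simp
  qed
  moreover have "((\<lambda>s. H s $ a) has_derivative (\<lambda>h. blinfun_apply (deriv_blinfun H (p, 0, 0)) h $ a)) (at (p, 0, 0))" for a
    by (rule bounded_linear.has_derivative[OF bounded_linear_vec_nth d[OF s0]])
  ultimately have "blinfun_apply (deriv_blinfun H (p, 0, 0)) h $ a = 0" for h a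
    by (metis has_derivative_unique)
  then have "deriv_blinfun H (p, 0, 0) = 0"
    by (intro blinfun_eqI) (simp add: vec_eq_iff)
  moreover have "H (p, 0, 0) = 0" by (simp add: H_def vec_eq_iff)
  ultimately show ?thesis using r d L by (intro that)
qed

section \<open>Harmonic disks in a chart\<close>

text \<open>The inverse, on the tangent space, of reading off the entry at chart \<open>c\<close>.
  It lets arguments about tangent families be carried out with coordinate vectors.\<close>

definition tangent_of_coords :: "('a, 'n::finite) chart set \<Rightarrow> ('a, 'n) chart \<Rightarrow> 'a \<Rightarrow> real ^ 'n \<Rightarrow> ('a, 'n) tangent"
  where "tangent_of_coords A c p v =
    (\<lambda>d. if d \<in> A \<and> p \<in> fst d then frechet_derivative (transition c d) (at (snd c p)) v else 0)"

lemma coord_vector_eq_tangent_of_coords: "coord_vector A c i p = tangent_of_coords A c p (axis i 1)"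
  by (simp add: coord_vector_def tangent_of_coords_def)

section \<open>Transition maps and tangent vectors in coordinates\<close>

context smooth_manifold
begin

lemma inj_on_chart: "c \<in> A \<Longrightarrow> inj_on (snd c) (fst c)"
  using homeomorphic_imp_injective_map[OF chart_homeomorphism, of c] openin_subset[OF chart_domain, of c]
  by (simp add: Int_absorb1)

lemma inv_chart [simp]: "c \<in> A \<Longrightarrow> p \<in> fst c \<Longrightarrow> inv_into (fst c) (snd c) (snd c p) = p"
  by (simp add: inv_into_f_f inj_on_chart)

lemma transition_apply [simp]: "c \<in> A \<Longrightarrow> p \<in> fst c \<Longrightarrow> transition c d (snd c p) = snd d p"
  by (simp add: transition_def)

lemma open_chart_image:
  assumes c: "c \<in> A" and W: "openin M W"
  shows "open (snd c ` (fst c \<inter> W))"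
proof -
  have "openin (subtopology M (fst c)) (fst c \<inter> W)"
    using W by (auto simp: openin_subtopology)
  then have "openin (top_of_set (snd c ` fst c)) (snd c ` (fst c \<inter> W))"
    using homeomorphic_imp_open_map[OF chart_homeomorphism[OF c]] by (simp add: open_map_def)
  then show ?thesis
    using chart_image[OF c] by (simp add: openin_open_eq)
qed

lemma transition_Ck: "c \<in> A \<Longrightarrow> d \<in> A \<Longrightarrow> Ck_on k (transition c d) (snd c ` (fst c \<inter> fst d))"
  using compatible[of c d] by (simp add: smooth_on_def)

lemma transition_has_derivative:
  assumes "c \<in> A" "d \<in> A" "p \<in> fst c" "p \<in> fst d"
  shows "(transition c d has_derivative blinfun_apply (deriv_blinfun (transition c d) (snd c p))) (at (snd c p))"
  by (rule has_derivative_deriv_blinfun[OF transition_Ck[OF assms(1,2), of "Suc 0"]]) (use assms in auto)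

lemma frechet_derivative_transition:
  assumes "c \<in> A" "d \<in> A" "p \<in> fst c" "p \<in> fst d"
  shows "frechet_derivative (transition c d) (at (snd c p)) = blinfun_apply (deriv_blinfun (transition c d) (snd c p))"
  using frechet_derivative_at[OF transition_has_derivative[OF assms]] by simp

text \<open>The chain rule for the composite of two transitions, which agrees with the direct one on
  the open image of the triple overlap.\<close>

lemma transition_cocycle:
  assumes A: "c \<in> A" "d \<in> A" "e \<in> A" and p: "p \<in> fst c" "p \<in> fst d" "p \<in> fst e"
  shows "blinfun_apply (deriv_blinfun (transition d e) (snd d p)) (blinfun_apply (deriv_blinfun (transition c d) (snd c p)) v) =
    blinfun_apply (deriv_blinfun (transition c e) (snd c p)) v"
proof -
  have o: "open (snd c ` (fst c \<inter> (fst d \<inter> fst e)))"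
    using A by (intro open_chart_image openin_Int chart_domain)
  have d: "((\<lambda>x. transition d e (transition c d x)) has_derivative
      (\<lambda>v. blinfun_apply (deriv_blinfun (transition d e) (snd d p)) (blinfun_apply (deriv_blinfun (transition c d) (snd c p)) v)))
      (at (snd c p))"
    by (rule has_derivative_compose[OF transition_has_derivative]) (use transition_has_derivative[of d e p] A p in simp_all)
  have "(transition c e has_derivative
      (\<lambda>v. blinfun_apply (deriv_blinfun (transition d e) (snd d p)) (blinfun_apply (deriv_blinfun (transition c d) (snd c p)) v)))
      (at (snd c p))"
    by (rule has_derivative_transform_within_open[OF d o]) (use A p in auto)
  from fun_cong[OF has_derivative_unique[OF this transition_has_derivative]] show ?thesis
    using A p by simp
qed

lemma deriv_transition_self:
  assumes "c \<in> A" "p \<in> fst c"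
  shows "blinfun_apply (deriv_blinfun (transition c c) (snd c p)) v = v"
proof -
  have "(transition c c has_derivative (\<lambda>v. v)) (at (snd c p))"
    by (rule has_derivative_transform_within_open[OF has_derivative_ident chart_image[OF assms(1)]]) (use assms in auto)
  from fun_cong[OF has_derivative_unique[OF this transition_has_derivative]] assms show ?thesis by simp
qed

lemma deriv_transition_inverse:
  assumes "c \<in> A" "d \<in> A" "p \<in> fst c" "p \<in> fst d"
  shows "blinfun_apply (deriv_blinfun (transition c d) (snd c p)) (blinfun_apply (deriv_blinfun (transition d c) (snd d p)) v) = v"
  using assms by (simp add: transition_cocycle deriv_transition_self)

lemma tangent_of_coords_apply:
  "c \<in> A \<Longrightarrow> p \<in> fst c \<Longrightarrow> d \<in> A \<Longrightarrow> p \<in> fst d \<Longrightarrow>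
    tangent_of_coords A c p v d = blinfun_apply (deriv_blinfun (transition c d) (snd c p)) v"
  by (simp add: tangent_of_coords_def frechet_derivative_transition)

lemma tangent_of_coords_in_tangent_space: "c \<in> A \<Longrightarrow> p \<in> fst c \<Longrightarrow> tangent_of_coords A c p v \<in> tangent_space A p"
  by (auto simp: tangent_space_def tangent_of_coords_apply frechet_derivative_transition transition_cocycle) (auto simp: tangent_of_coords_def)

lemma tangent_of_coords_of_tangent: "c \<in> A \<Longrightarrow> p \<in> fst c \<Longrightarrow> X \<in> tangent_space A p \<Longrightarrow> tangent_of_coords A c p (X c) = X"
proof
  fix d
  assume c: "c \<in> A" "p \<in> fst c" and X: "X \<in> tangent_space A p"
  show "tangent_of_coords A c p (X c) d = X d"
  proof (cases "d \<in> A \<and> p \<in> fst d")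
    case True
    then have "X d = frechet_derivative (transition c d) (at (snd c p)) (X c)"
      using c X unfolding tangent_space_def by blast
    then show ?thesis using True by (simp add: tangent_of_coords_def)
  next
    case False
    then have "X d = 0" using X unfolding tangent_space_def by blast
    then show ?thesis using False unfolding tangent_of_coords_def by argo
  qed
qed

lemma tangent_of_coords_self: "c \<in> A \<Longrightarrow> p \<in> fst c \<Longrightarrow> tangent_of_coords A c p v c = v"
  by (simp add: tangent_of_coords_apply deriv_transition_self)

lemma tangent_of_coords_change_chart:
  assumes "c \<in> A" "d \<in> A" "p \<in> fst c" "p \<in> fst d"
  shows "tangent_of_coords A d p (blinfun_apply (deriv_blinfun (transition c d) (snd c p)) v) = tangent_of_coords A c p v"
proof
  fix e
  show "tangent_of_coords A d p (blinfun_apply (deriv_blinfun (transition c d) (snd c p)) v) e = tangent_of_coords A c p v e"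
    using assms by (cases "e \<in> A \<and> p \<in> fst e") (auto simp: tangent_of_coords_apply transition_cocycle, simp_all add: tangent_of_coords_def)
qed

lemma tangent_of_coords_linear:
  assumes "c \<in> A" "p \<in> fst c"
  shows "tangent_of_coords A c p (a *\<^sub>R v + b *\<^sub>R w) = (\<lambda>e. a *\<^sub>R tangent_of_coords A c p v e + b *\<^sub>R tangent_of_coords A c p w e)"
proof
  fix e
  show "tangent_of_coords A c p (a *\<^sub>R v + b *\<^sub>R w) e = a *\<^sub>R tangent_of_coords A c p v e + b *\<^sub>R tangent_of_coords A c p w e"
    using assms by (cases "e \<in> A \<and> p \<in> fst e") (auto simp: tangent_of_coords_apply blinfun.bilinear_simps, simp_all add: tangent_of_coords_def)
qed

text \<open>On the chart image \<open>inv_into\<close> coincides with the continuous inverse that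
  the homeomorphism provides.\<close>

lemma continuous_map_inv_chart:
  assumes c: "c \<in> A"
  shows "continuous_map (top_of_set (snd c ` fst c)) M (inv_into (fst c) (snd c))"
proof -
  obtain h where h: "homeomorphic_maps (subtopology M (fst c)) (top_of_set (snd c ` fst c)) (snd c) h"
    using chart_homeomorphism[OF c] homeomorphic_map_maps by blast
  then have "continuous_map (top_of_set (snd c ` fst c)) M h"
    by (auto simp: homeomorphic_maps_def continuous_map_in_subtopology)
  moreover have "h x = inv_into (fst c) (snd c) x" if "x \<in> snd c ` fst c" for x
    using h that c openin_subset[OF chart_domain[OF c]]
    by (auto simp: homeomorphic_maps_def)
  ultimately show ?thesis by (auto intro: continuous_map_eq)
qed

end

section \<open>The metric in coordinates and the change of chart\<close>

context riemannian_manifold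
begin

text \<open>Symmetry extends linearity to the second argument, and expansion in the coordinate
  vectors gives the matrix. Through this formula symmetry, positivity and the transformation law
  become statements about matrices.\<close>

lemma metric_tangent_of_coords:
  assumes c: "c \<in> A" "p \<in> fst c"
  shows "g p (tangent_of_coords A c p v) (tangent_of_coords A c p w) = v \<bullet> (metric_matrix A g c (snd c p) *v w)"
proof -
  let ?B = "\<lambda>v w. g p (tangent_of_coords A c p v) (tangent_of_coords A c p w)"
  have p: "p \<in> topspace M" using openin_subset[OF chart_domain[OF c(1)]] c(2) by auto
  note t = tangent_of_coords_in_tangent_space[OF c]
  have lin1: "?B (a *\<^sub>R v + b *\<^sub>R v') w = a * ?B v w + b * ?B v' w" for a b v v' w
    unfolding tangent_of_coords_linear[OF c] by (rule metric_linear[OF p t t t])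
  have sym: "?B v w = ?B w v" for v w
    by (rule metric_sym[OF p t t])
  have l1: "linear (\<lambda>v. ?B v w)" for w
    using lin1[of 1 _ 1 _ w] lin1[of _ _ 0 0 w] by (intro linearI) simp_all
  have l2: "linear (\<lambda>w. ?B v w)" for v
    using l1[of v] by (simp add: sym)
  have "?B v w = ?B (\<Sum>i\<in>UNIV. (v $ i) *\<^sub>R axis i 1) (\<Sum>j\<in>UNIV. (w $ j) *\<^sub>R axis j 1)"
    using vec_eq_sum_axis[of v] vec_eq_sum_axis[of w] by simp
  also have "\<dots> = (\<Sum>i\<in>UNIV. v $ i * ?B (axis i 1) (\<Sum>j\<in>UNIV. (w $ j) *\<^sub>R axis j 1))"
    by (simp only: linear_sum[OF l1] linear_scale[OF l1] real_scaleR_def)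
  also have "\<dots> = (\<Sum>i\<in>UNIV. v $ i * (\<Sum>j\<in>UNIV. w $ j * ?B (axis i 1) (axis j 1)))"
    by (simp only: linear_sum[OF l2] linear_scale[OF l2] real_scaleR_def)
  also have "\<dots> = v \<bullet> (metric_matrix A g c (snd c p) *v w)"
    using c by (simp add: inner_vec_def matrix_vector_mult_def metric_matrix_def coord_vector_eq_tangent_of_coords mult_ac)
  finally show ?thesis .
qed

lemma metric_matrix_sym:
  assumes c: "c \<in> A" "p \<in> fst c"
  shows "v \<bullet> (metric_matrix A g c (snd c p) *v w) = w \<bullet> (metric_matrix A g c (snd c p) *v v)"
proof -
  have p: "p \<in> topspace M" using openin_subset[OF chart_domain[OF c(1)]] c(2) by auto
  show ?thesis
    unfolding metric_tangent_of_coords[OF c, symmetric] by (rule metric_sym[OF p]) (rule tangent_of_coords_in_tangent_space[OF c])+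
qed

lemma metric_matrix_pos:
  assumes c: "c \<in> A" "p \<in> fst c" and v: "v \<noteq> 0"
  shows "0 < v \<bullet> (metric_matrix A g c (snd c p) *v v)"
proof -
  have p: "p \<in> topspace M" using openin_subset[OF chart_domain[OF c(1)]] c(2) by auto
  have "tangent_of_coords A c p v \<noteq> (\<lambda>_. 0)"
    using fun_cong[of "tangent_of_coords A c p v" "\<lambda>_. 0" c] tangent_of_coords_self[OF c, of v] v by argo
  then show ?thesis
    unfolding metric_tangent_of_coords[OF c, symmetric] by (intro metric_pos[OF p] tangent_of_coords_in_tangent_space[OF c])
qed

lemma invertible_metric_matrix:
  assumes c: "c \<in> A" "p \<in> fst c"
  shows "invertible (metric_matrix A g c (snd c p))"
  unfolding invertible_left_inverse matrix_left_invertible_ker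
proof (intro allI impI, rule ccontr)
  fix v assume "metric_matrix A g c (snd c p) *v v = 0" "v \<noteq> 0"
  then show False using metric_matrix_pos[OF c, of v] by simp
qed

lemma metric_matrix_change_chart:
  assumes "c \<in> A" "d \<in> A" "p \<in> fst c" "p \<in> fst d"
  shows "v \<bullet> (metric_matrix A g c (snd c p) *v w) =
    blinfun_apply (deriv_blinfun (transition c d) (snd c p)) v \<bullet>
      (metric_matrix A g d (snd d p) *v blinfun_apply (deriv_blinfun (transition c d) (snd c p)) w)"
  using assms by (simp add: metric_tangent_of_coords[symmetric] tangent_of_coords_change_chart)

lemma metric_matrix_has_derivative:
  assumes c: "c \<in> A" "p \<in> fst c"
  shows "(metric_matrix A g c has_derivative blinfun_apply (deriv_blinfun (metric_matrix A g c) (snd c p))) (at (snd c p))"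
proof (rule has_derivative_deriv_blinfun)
  show "Ck_on (Suc 0) (metric_matrix A g c) (snd c ` fst c)"
    using metric_smooth[OF c(1)] by (intro Ck_on_vecI chart_image c) (simp only: smooth_on_def)
qed (use c in auto)

text \<open>\<open>harmonic_on_disk\<close> asks for the equation in every chart of
  \<open>A\<close>, while the solution is built in \<open>c\<close> alone. On the overlap with a
  chart \<open>d\<close> the equation is put into tested form, transported along the transition map
  and read off again in \<open>d\<close>.\<close>

lemma harmonic_on_disk_chart:
  fixes v P Q :: "real \<times> real \<Rightarrow> real ^ 'n" and P' Q'
  assumes c: "c \<in> A"
    and v: "\<And>z. (v has_derivative blinfun_apply (pd_blinfun (P z) (Q z))) (at z)"
    and P: "\<And>z. (P has_derivative blinfun_apply (P' z)) (at z)" "continuous_on UNIV P'"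
    and Q: "\<And>z. (Q has_derivative blinfun_apply (Q' z)) (at z)" "continuous_on UNIV Q'"
    and range: "\<And>z. z \<in> ball 0 1 \<Longrightarrow> v z \<in> snd c ` fst c"
    and eq: "\<And>z a. z \<in> ball 0 1 \<Longrightarrow>
      (blinfun_apply (P' z) (1, 0) + blinfun_apply (Q' z) (0, 1)) $ a +
      (\<Sum>b\<in>UNIV. \<Sum>k\<in>UNIV. christoffel A g c a b k (v z) * (P z $ b * P z $ k + Q z $ b * Q z $ k)) = 0"
  defines "u \<equiv> \<lambda>z. inv_into (fst c) (snd c) (v z)"
  shows "harmonic_on_disk M A g 1 u"
    and "map_deriv A u (1, 0) 0 = tangent_of_coords A c (u 0) (P 0)" "map_deriv A u (0, 1) 0 = tangent_of_coords A c (u 0) (Q 0)"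
proof -
  have cv: "continuous_on S v" for S
    by (intro continuous_at_imp_continuous_on ballI has_derivative_continuous[OF v])
  have cP: "continuous_on S P" and cQ: "continuous_on S Q" for S
    by (intro continuous_at_imp_continuous_on ballI has_derivative_continuous[OF P(1)] has_derivative_continuous[OF Q(1)])+
  have C1: "Ck_on (Suc 0) P UNIV" "Ck_on (Suc 0) Q UNIV"
    by (rule Ck_on_SucI[OF open_UNIV P(1)], simp, intro continuous_intros P(2))
      (rule Ck_on_SucI[OF open_UNIV Q(1)], simp, intro continuous_intros Q(2))
  have C2: "Ck_on 2 v UNIV"
    unfolding numeral_2_eq_2
  proof (rule Ck_on_SucI[OF open_UNIV v])
    fix e :: "real \<times> real"
    show "Ck_on (Suc 0) (\<lambda>z. blinfun_apply (pd_blinfun (P z) (Q z)) e) UNIV"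
      unfolding pd_blinfun_apply
      by (intro Ck_on_add Ck_on_linear_comp[OF bounded_linear_scaleR_right] C1 open_UNIV)
  qed
  have uc: "u z \<in> fst c" "snd c (u z) = v z" if "z \<in> ball 0 1" for z
    using range[OF that] by (simp_all add: u_def inv_into_into f_inv_into_f)
  \<comment> \<open>The disk may leave the domain of \<open>d\<close>, so the equation in
    \<open>d\<close> concerns this part only; being open, it is a legitimate domain for
    \<open>Ck_on\<close>.\<close>
  define N where "N d = {z \<in> ball 0 1. u z \<in> fst d}" for d :: "('a, 'n) chart"
  have N_eq: "N d = ball 0 1 \<inter> v -` (snd c ` (fst c \<inter> fst d))" if "d \<in> A" for d
  proof (intro set_eqI iffI)
    fix z assume z: "z \<in> N d"
    then have "z \<in> ball 0 1" "u z \<in> fst d" by (auto simp: N_def)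
    with uc[of z] show "z \<in> ball 0 1 \<inter> v -` (snd c ` (fst c \<inter> fst d))"
      by (metis IntI image_eqI vimageI)
  next
    fix z assume z: "z \<in> ball 0 1 \<inter> v -` (snd c ` (fst c \<inter> fst d))"
    then show "z \<in> N d" using c by (auto simp: N_def u_def)
  qed
  have opN: "open (N d)" if d: "d \<in> A" for d
    unfolding N_eq[OF d] by (intro continuous_open_preimage cv open_ball open_chart_image c chart_domain d)
  define \<tau> where "\<tau> d = transition c d" for d
  define J where "J d z = deriv_blinfun (\<tau> d) (v z)" for d z
  have \<tau>v: "snd d (u z) = \<tau> d (v z)" if "z \<in> N d" for d z
    using that uc[of z] transition_apply[OF c, of "u z" d] by (simp add: \<tau>_def N_def)
  have vS: "v z \<in> snd c ` (fst c \<inter> fst d)" if "z \<in> N d" "d \<in> A" for z d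
    using that N_eq by auto
  have d\<tau>: "(\<tau> d has_derivative blinfun_apply (J d z)) (at (v z))" if "z \<in> N d" "d \<in> A" for d z
    unfolding J_def \<tau>_def
    by (rule has_derivative_deriv_blinfun[OF transition_Ck[OF c that(2), of "Suc 0"] vS[OF that]])
  have dw: "((\<lambda>z. snd d (u z)) has_derivative (\<lambda>h. blinfun_apply (J d z) (blinfun_apply (pd_blinfun (P z) (Q z)) h))) (at z)"
    if z: "z \<in> N d" and d: "d \<in> A" for d z
    by (rule has_derivative_transform_within_open[OF has_derivative_compose[OF v d\<tau>[OF z d]] opN[OF d] z])
      (simp add: \<tau>v)
  have 0: "0 \<in> N d" if "u 0 \<in> fst d" for d using that by (simp add: N_def)
  have u0: "u 0 \<in> fst c" "snd c (u 0) = v 0" using uc[of 0] by simp_all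
  have md: "map_deriv A u e 0 = tangent_of_coords A c (u 0) (fst e *\<^sub>R P 0 + snd e *\<^sub>R Q 0)" for e
  proof
    fix d
    show "map_deriv A u e 0 d = tangent_of_coords A c (u 0) (fst e *\<^sub>R P 0 + snd e *\<^sub>R Q 0) d"
    proof (cases "d \<in> A \<and> u 0 \<in> fst d")
      case True
      then have "map_deriv A u e 0 d = blinfun_apply (J d 0) (fst e *\<^sub>R P 0 + snd e *\<^sub>R Q 0)"
        using partial_deriv_eq[OF dw[OF 0]] by (simp add: map_deriv_def)
      then show ?thesis using True tangent_of_coords_apply[OF c u0(1), of d] u0(2) by (simp add: J_def \<tau>_def)
    qed (auto simp: map_deriv_def tangent_of_coords_def)
  qed
  show "map_deriv A u (1, 0) 0 = tangent_of_coords A c (u 0) (P 0)" "map_deriv A u (0, 1) 0 = tangent_of_coords A c (u 0) (Q 0)"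
    using md[of "(1, 0)"] md[of "(0, 1)"] by simp_all
  have cont: "continuous_map (top_of_set (ball 0 1)) M u"
  proof -
    have "continuous_map (top_of_set (ball 0 1)) (top_of_set (snd c ` fst c)) v"
      using cv range by (auto simp: continuous_map_in_subtopology)
    from continuous_map_compose[OF this continuous_map_inv_chart[OF c]]
    show ?thesis by (simp add: u_def comp_def)
  qed
  have Ck: "Ck_on 2 (\<lambda>z. snd d (u z)) (N d)" if d: "d \<in> A" for d
  proof (rule Ck_on_cong[OF opN[OF d]])
    show "Ck_on 2 (\<lambda>z. \<tau> d (v z)) (N d)"
      unfolding \<tau>_def
      by (rule Ck_on_compose[OF opN[OF d] _ Ck_on_subset[OF C2] transition_Ck[OF c d]]) (use vS d in blast)+
  qed (simp add: \<tau>v)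
  have EL: "laplacian (\<lambda>w. snd d (u w) $ a) z + (\<Sum>b\<in>UNIV. \<Sum>k\<in>UNIV. christoffel A g d a b k (snd d (u z)) *
      (d_x (\<lambda>w. snd d (u w) $ b) z * d_x (\<lambda>w. snd d (u w) $ k) z
       + d_y (\<lambda>w. snd d (u w) $ b) z * d_y (\<lambda>w. snd d (u w) $ k) z)) = 0"
    if d: "d \<in> A" and z: "z \<in> N d" for d z a
  proof -
    let ?S = "snd c ` (fst c \<inter> fst d)"
    have zb: "z \<in> ball 0 1" and ud: "u z \<in> fst d" using z by (auto simp: N_def)
    have S: "open ?S" by (intro open_chart_image c chart_domain d)
    have Ck1: "Ck_on (Suc 0) (deriv_blinfun (\<tau> d)) ?S"
      unfolding \<tau>_def by (intro Ck_on_deriv_blinfun S transition_Ck c d)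
    define J' where "J' = deriv_blinfun (deriv_blinfun (\<tau> d)) (v z)"
    have dJ: "(deriv_blinfun (\<tau> d) has_derivative blinfun_apply J') (at (v z))"
      unfolding J'_def by (rule has_derivative_deriv_blinfun[OF Ck1 vS[OF z d]])
    have sym: "blinfun_apply (blinfun_apply J' a) b = blinfun_apply (blinfun_apply J' b) a" for a b
      unfolding J'_def by (rule second_derivative_symmetric[OF S vS[OF z d]]) (simp only: \<tau>_def transition_Ck[OF c d])
    have comp: "partial_deriv e (\<lambda>w. snd d (u w) $ b) y = blinfun_apply (J d y) (fst e *\<^sub>R P y + snd e *\<^sub>R Q y) $ b"
      if "y \<in> N d" for e b y
      using partial_deriv_eq[OF bounded_linear.has_derivative[OF bounded_linear_vec_nth dw[OF that d]]] by simp
    \<comment> \<open>Chain and product rule for \<open>d_x\<close> or \<open>d_y\<close> taken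
      twice: \<open>F\<close> is the derivative of \<open>v\<close> along \<open>e\<close>, that is
      \<open>P\<close> or \<open>Q\<close>, and \<open>J'\<close> brings in the second derivative of
      the transition map.\<close>
    have second: "partial_deriv e (partial_deriv e (\<lambda>w. snd d (u w) $ a)) z =
        (blinfun_apply (blinfun_apply J' R) R + blinfun_apply (J d z) (blinfun_apply R' e)) $ a"
      if R: "\<And>y. fst e *\<^sub>R P y + snd e *\<^sub>R Q y = F y" and F: "F z = R" "(F has_derivative blinfun_apply R') (at z)"
      for e R R' F a
    proof -
      have "((\<lambda>y. J d y) has_derivative (\<lambda>h. blinfun_apply J' (blinfun_apply (pd_blinfun (P z) (Q z)) h))) (at z)"
        unfolding J_def by (rule has_derivative_compose[OF v dJ])
      from bounded_linear.has_derivative[OF bounded_linear_vec_nth bounded_bilinear.FDERIV[OF bounded_bilinear_blinfun_apply this F(2)]]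
      have "((\<lambda>y. blinfun_apply (J d y) (F y) $ a) has_derivative
          (\<lambda>h. (blinfun_apply (J d z) (blinfun_apply R' h) +
            blinfun_apply (blinfun_apply J' (blinfun_apply (pd_blinfun (P z) (Q z)) h)) (F z)) $ a)) (at z)" .
      then have "(partial_deriv e (\<lambda>w. snd d (u w) $ a) has_derivative
          (\<lambda>h. (blinfun_apply (J d z) (blinfun_apply R' h) +
            blinfun_apply (blinfun_apply J' (blinfun_apply (pd_blinfun (P z) (Q z)) h)) (F z)) $ a)) (at z)"
        by (rule has_derivative_transform_within_open[OF _ opN[OF d] z]) (simp add: comp R)
      then show ?thesis
        by (simp add: partial_deriv_eq R F)
    qed
    let ?w = "blinfun_apply (P' z) (1, 0) + blinfun_apply (Q' z) (0, 1)"
    let ?w' = "blinfun_apply (J d z) ?w + blinfun_apply (blinfun_apply J' (P z)) (P z) + blinfun_apply (blinfun_apply J' (Q z)) (Q z)"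
    have lap: "laplacian (\<lambda>w. snd d (u w) $ a) z = ?w' $ a" for a
    proof -
      have "d_x (d_x (\<lambda>w. snd d (u w) $ a)) z =
          (blinfun_apply (blinfun_apply J' (P z)) (P z) + blinfun_apply (J d z) (blinfun_apply (P' z) (1, 0))) $ a"
        by (rule second[OF _ refl P(1)]) simp
      moreover have "d_y (d_y (\<lambda>w. snd d (u w) $ a)) z =
          (blinfun_apply (blinfun_apply J' (Q z)) (Q z) + blinfun_apply (J d z) (blinfun_apply (Q' z) (0, 1))) $ a"
        by (rule second[OF _ refl Q(1)]) simp
      ultimately show ?thesis by (simp add: laplacian_def blinfun.add_right)
    qed
    let ?m = "metric_matrix A g c" and ?m' = "metric_matrix A g d"
    have vz: "snd c (u z) = v z" and uz: "u z \<in> fst c" using uc[OF zb] by simp_all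
    note dm = metric_matrix_has_derivative[OF c uz, unfolded vz]
    note dm' = metric_matrix_has_derivative[OF d ud, unfolded \<tau>v[OF z]]
    note inv = invertible_metric_matrix[OF c uz, unfolded vz] and inv' = invertible_metric_matrix[OF d ud, unfolded \<tau>v[OF z]]
    have E: "euler_lagrange (?m (v z)) (blinfun_apply (deriv_blinfun ?m (v z))) ?w (P z) (Q z) l = 0" for l
      using tension_zero_iff[OF dm inv, of ?w "P z" "Q z"] eq[OF zb] by blast
    have T: "euler_lagrange (?m (v z)) (blinfun_apply (deriv_blinfun ?m (v z))) ?w (P z) (Q z) l =
        euler_lagrange (?m' (\<tau> d (v z))) (blinfun_apply (deriv_blinfun ?m' (\<tau> d (v z)))) ?w'
          (blinfun_apply (J d z) (P z)) (blinfun_apply (J d z) (Q z)) (blinfun_apply (J d z) l)" for l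
      unfolding J_def
    proof (rule euler_lagrange_transform[OF S vS[OF z d] _ d\<tau>[OF z d, unfolded J_def] dJ sym dm dm'])
      show "a \<bullet> (?m' (\<tau> d (v z)) *v b) = b \<bullet> (?m' (\<tau> d (v z)) *v a)" for a b
        using metric_matrix_sym[OF d ud] by (simp add: \<tau>v[OF z])
      show "a \<bullet> (?m y *v b) = blinfun_apply (deriv_blinfun (\<tau> d) y) a \<bullet> (?m' (\<tau> d y) *v blinfun_apply (deriv_blinfun (\<tau> d) y) b)"
        if y: "y \<in> ?S" for y a b
      proof -
        from y obtain q where q: "q \<in> fst c" "q \<in> fst d" "y = snd c q" by auto
        then show ?thesis using metric_matrix_change_chart[OF c d q(1,2), of a b] c by (simp add: \<tau>_def)
      qed
    qed
    \<comment> \<open>So far the equation in \<open>d\<close> is tested only with vectors in the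
      image of \<open>J d z\<close>; the derivative of the reverse transition shows that every
      vector is of this form.\<close>
    have "euler_lagrange (?m' (\<tau> d (v z))) (blinfun_apply (deriv_blinfun ?m' (\<tau> d (v z)))) ?w'
          (blinfun_apply (J d z) (P z)) (blinfun_apply (J d z) (Q z)) l = 0" for l
    proof -
      have "blinfun_apply (J d z) (blinfun_apply (deriv_blinfun (transition d c) (snd d (u z))) l) = l"
        using deriv_transition_inverse[OF c d uz ud] by (simp add: J_def \<tau>_def vz)
      then show ?thesis using T E by metis
    qed
    then have "?w' $ a + (\<Sum>b\<in>UNIV. \<Sum>k\<in>UNIV. christoffel A g d a b k (\<tau> d (v z)) *
        (blinfun_apply (J d z) (P z) $ b * blinfun_apply (J d z) (P z) $ k + blinfun_apply (J d z) (Q z) $ b * blinfun_apply (J d z) (Q z) $ k)) = 0"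
      using tension_zero_iff[OF dm' inv', of ?w' "blinfun_apply (J d z) (P z)" "blinfun_apply (J d z) (Q z)"] by blast
    then show ?thesis
      unfolding lap \<tau>v[OF z] comp[OF z] by simp
  qed
  show "harmonic_on_disk M A g 1 u"
    unfolding harmonic_on_disk_def
    using cont Ck EL by (auto simp: N_def)
qed

end

section \<open>Existence of a conformal harmonic disk\<close>

context riemannian_manifold
begin

lemma ex_conformal_partner:
  assumes c: "c \<in> A" "p \<in> fst c" and dim: "2 \<le> CARD('n)"
  obtains w where "v \<bullet> (metric_matrix A g c (snd c p) *v w) = 0"
    "w \<bullet> (metric_matrix A g c (snd c p) *v w) = v \<bullet> (metric_matrix A g c (snd c p) *v v)"
proof -
  let ?m = "metric_matrix A g c (snd c p)"
  note pos = metric_matrix_pos[OF c]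
  have "dim {?m *v v} \<le> card {?m *v v}" by (rule dim_le_card') simp
  \<comment> \<open>The dimension hypothesis enters here: one vector spans at most a line, so some
    nonzero \<open>y\<close> is orthogonal to it. Euclidean orthogonality to \<open>?m *v v\<close>
    is orthogonality to \<open>v\<close> for the metric.\<close>
  then have "dim {?m *v v} < DIM(real ^ 'n)" using dim by simp
  then obtain y where y: "y \<noteq> 0" "\<And>x. x \<in> span {?m *v v} \<Longrightarrow> orthogonal y x"
    using orthogonal_to_subspace_exists by blast
  have "orthogonal y (?m *v v)" by (intro y(2) span_base singletonI)
  then have vy: "v \<bullet> (?m *v y) = 0"
    by (simp add: orthogonal_def metric_matrix_sym[OF c, of v y])
  \<comment> \<open>This factor gives \<open>y\<close> the metric length of \<open>v\<close>; for
    \<open>v = 0\<close> it is 0.\<close>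
  define t where "t = sqrt ((v \<bullet> (?m *v v)) / (y \<bullet> (?m *v y)))"
  have "0 \<le> v \<bullet> (?m *v v)" using pos[of v] by (cases "v = 0") auto
  then have "t\<^sup>2 = (v \<bullet> (?m *v v)) / (y \<bullet> (?m *v y))"
    unfolding t_def using pos[OF y(1)] by simp
  then have "t\<^sup>2 * (y \<bullet> (?m *v y)) = v \<bullet> (?m *v v)"
    using pos[OF y(1)] by simp
  then show ?thesis
    using vy by (intro that[of "t *\<^sub>R y"]) (simp_all add: matrix_vector_mult_scaleR power2_eq_square)
qed

lemma ex_harmonic_disk:
  assumes p: "p \<in> topspace M" and X: "X \<in> tangent_space A p" and dim: "2 \<le> CARD('n)"
  obtains \<alpha> u where "0 < \<alpha>" "harmonic_on_disk M A g 1 u" "conformal_at_0 A g u" "u 0 = p"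
    "map_deriv A u (1, 0) 0 = (\<lambda>c. X c /\<^sub>R \<alpha>)"
proof -
  from p cover obtain c where c: "c \<in> A" "p \<in> fst c" by blast
  let ?m = "metric_matrix A g c (snd c p)" and ?U = "snd c ` fst c"
  define v where "v = X c"
  obtain w where w: "v \<bullet> (?m *v w) = 0" "w \<bullet> (?m *v w) = v \<bullet> (?m *v v)"
    using ex_conformal_partner[OF c dim, of v] by blast
  have \<gamma>: "Ck_on 2 (christoffel A g c a b k) ?U" for a b k
    by (rule Ck_on_christoffel[OF chart_image[OF c(1)] metric_smooth[OF c(1)]])
      (use invertible_metric_matrix[OF c(1)] in auto)
  have x0: "snd c p \<in> ?U" using c by simp
  define H where "H = (\<lambda>s. \<chi> a. \<Sum>b\<in>UNIV. \<Sum>k\<in>UNIV. christoffel A g c a b k (fst s) *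
    (fst (snd s) $ b * fst (snd s) $ k + snd (snd s) $ b * snd (snd s) $ k))"
  obtain r H' L where H: "0 < r" "cball (snd c p) r \<subseteq> ?U"
    "\<And>s. s \<in> cball (snd c p, 0, 0) r \<Longrightarrow> (H has_derivative blinfun_apply (H' s)) (at s)"
    "L-lipschitz_on (cball (snd c p, 0, 0) r) H'" "H (snd c p, 0, 0) = 0" "H' (snd c p, 0, 0) = 0"
    by (rule quadratic_form_C1_lipschitz[OF H_def chart_image[OF c(1)] \<gamma> x0]) (rule that)
  obtain \<delta> where \<delta>: "0 < \<delta>" "\<And>a b. norm a \<le> \<delta> \<Longrightarrow> norm b \<le> \<delta> \<Longrightarrow> \<exists>u P Q P' Q'.
       (\<forall>z. (u has_derivative blinfun_apply (pd_blinfun (P z) (Q z))) (at z)) \<and>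
       (\<forall>z. (P has_derivative blinfun_apply (P' z)) (at z)) \<and> continuous_on UNIV P' \<and>
       (\<forall>z. (Q has_derivative blinfun_apply (Q' z)) (at z)) \<and> continuous_on UNIV Q' \<and>
       u 0 = snd c p \<and> P 0 = a \<and> Q 0 = b \<and>
       (\<forall>z\<in>ball 0 1. (u z, P z, Q z) \<in> cball (snd c p, 0, 0) r \<and>
          blinfun_apply (P' z) (1, 0) + blinfun_apply (Q' z) (0, 1) = - H (u z, P z, Q z))"
    by (rule local_solution[OF H(1,3-6)]) (assumption, rule that)
  \<comment> \<open>Large enough to bring both \<open>v\<close> and \<open>w\<close> below \<delta>
    after division, with the summand 1 keeping it positive. Division by a common factor preserves
    orthogonality and equality of lengths.\<close>
  define \<alpha> where "\<alpha> = (norm v + norm w + 1) / \<delta>"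
  have \<alpha>: "0 < \<alpha>"
    unfolding \<alpha>_def using \<delta>(1) norm_ge_zero[of v] norm_ge_zero[of w] by (intro divide_pos_pos) linarith+
  have small: "norm (x /\<^sub>R \<alpha>) \<le> \<delta>" if "norm x \<le> norm v + norm w + 1" for x :: "real ^ 'n"
  proof -
    have "norm x \<le> \<delta> * \<alpha>" using that \<delta>(1) by (simp add: \<alpha>_def)
    then show ?thesis using \<alpha> by (simp add: field_simps)
  qed
  have "norm (v /\<^sub>R \<alpha>) \<le> \<delta>" "norm (w /\<^sub>R \<alpha>) \<le> \<delta>" by (rule small, simp)+
  from \<delta>(2)[OF this] obtain f P Q P' Q' where
    f: "\<And>z. (f has_derivative blinfun_apply (pd_blinfun (P z) (Q z))) (at z)"
    and P: "\<And>z. (P has_derivative blinfun_apply (P' z)) (at z)" "continuous_on UNIV P'"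
    and Q: "\<And>z. (Q has_derivative blinfun_apply (Q' z)) (at z)" "continuous_on UNIV Q'"
    and init: "f 0 = snd c p" "P 0 = v /\<^sub>R \<alpha>" "Q 0 = w /\<^sub>R \<alpha>"
    and sol: "\<And>z. z \<in> ball 0 1 \<Longrightarrow> (f z, P z, Q z) \<in> cball (snd c p, 0, 0) r"
      "\<And>z. z \<in> ball 0 1 \<Longrightarrow> blinfun_apply (P' z) (1, 0) + blinfun_apply (Q' z) (0, 1) = - H (f z, P z, Q z)"
    by (elim exE conjE) (rule that, blast+)
  have range: "f z \<in> ?U" if "z \<in> ball 0 1" for z
    using sol(1)[OF that] dist_fst_le[of "(snd c p, 0, 0)" "(f z, P z, Q z)"] H(2) by auto
  have eq: "(blinfun_apply (P' z) (1, 0) + blinfun_apply (Q' z) (0, 1)) $ a +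
      (\<Sum>b\<in>UNIV. \<Sum>k\<in>UNIV. christoffel A g c a b k (f z) * (P z $ b * P z $ k + Q z $ b * Q z $ k)) = 0"
    if "z \<in> ball 0 1" for z a
    unfolding sol(2)[OF that] by (simp add: H_def)
  define u where "u z = inv_into (fst c) (snd c) (f z)" for z
  have harmonic: "harmonic_on_disk M A g 1 u"
    unfolding u_def[abs_def] by (rule harmonic_on_disk_chart(1)[OF c(1) f P Q range eq])
  have dx: "map_deriv A u (1, 0) 0 = tangent_of_coords A c (u 0) (P 0)"
    unfolding u_def[abs_def] by (rule harmonic_on_disk_chart(2)[OF c(1) f P Q range eq])
  have dy: "map_deriv A u (0, 1) 0 = tangent_of_coords A c (u 0) (Q 0)"
    unfolding u_def[abs_def] by (rule harmonic_on_disk_chart(3)[OF c(1) f P Q range eq])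
  have u0: "u 0 = p" using c by (simp add: u_def init)
  have scale: "tangent_of_coords A c p (x /\<^sub>R \<alpha>) = (\<lambda>d. tangent_of_coords A c p x d /\<^sub>R \<alpha>)" for x
    using tangent_of_coords_linear[OF c, of "inverse \<alpha>" x 0 0] by simp
  show ?thesis
  proof (rule that[OF \<alpha> harmonic _ u0])
    show "conformal_at_0 A g u"
      unfolding conformal_at_0_def dx dy u0 init metric_tangent_of_coords[OF c]
      using w by (simp add: matrix_vector_mult_scaleR)
    show "map_deriv A u (1, 0) 0 = (\<lambda>c. X c /\<^sub>R \<alpha>)"
      unfolding dx u0 init scale v_def tangent_of_coords_of_tangent[OF c X] ..
  qed
qed

end

text \<open>In dimension one two orthogonal vectors of equal length both vanish, so no disk would
  realise a nonzero \<open>X\<close>; this explains the bound on the dimension.\<close>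

theorem theorem1p3:
  fixes M :: "'a topology" and A :: "('a, 'n::finite) chart set" and g :: "('a, 'n) metric"
  assumes "riemannian_manifold M A g"
    and "2 \<le> CARD('n)"
  shows "\<forall>p \<in> topspace M. \<forall>X \<in> tangent_space A p.
           0 \<le> kobayashi_metric M A g p X \<and> kobayashi_metric M A g p X < \<infinity>"
proof (intro ballI conjI)
  fix p X assume p: "p \<in> topspace M" and X: "X \<in> tangent_space A p"
  show "0 \<le> kobayashi_metric M A g p X"
    unfolding kobayashi_metric_def by (auto intro!: INF_greatest)
  obtain \<alpha> u where "0 < \<alpha>" "harmonic_on_disk M A g 1 u" "conformal_at_0 A g u" "u 0 = p"
    "map_deriv A u (1, 0) 0 = (\<lambda>c. X c /\<^sub>R \<alpha>)"
    using riemannian_manifold.ex_harmonic_disk[OF assms(1) p X assms(2)] by blast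
  \<comment> \<open>The maximum with 0 also covers the zero vector, where the metric is 0 by
    definition.\<close>
  then have "kobayashi_metric M A g p X \<le> max 0 (ereal \<alpha>)"
    unfolding kobayashi_metric_def by (auto intro!: INF_lower2[of \<alpha>])
  then show "kobayashi_metric M A g p X < \<infinity>"
    by (rule order_le_less_trans) (simp add: max_def)
qed

end
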